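(* Let $\rho>1$ be a real number and let $\eta\in(0,1)$. Then there exists $p^{\ast}=p^{\ast}(\eta,\rho)$ with $0<p^{\ast}<1$ such that the following holds: for every $p_h\in(p^{\ast},1)$, letting $p_v\in(0,1)$ be the parameter determined by $\frac{1-p_v}{p_v}=\eta\,\frac{1-p_h}{p_h}$ and $\mathbf{p}=(p_h,p_v)$, and for every point $x=(x_1,x_2)$ with $x_1,x_2$ positive integers and $x_2=\rho x_1$, one has, with $x'=(x_2,x_1)$, $$\tau^{f}_{\mathbf{p}}(0,x)>\tau^{f}_{\mathbf{p}}(0,x').$$
   Context: Anisotropic bond percolation on $\mathbb{Z}^2$: consider the square lattice, i.e. the graph with vertex set $\mathbb{Z}^2$ and edge set $\mathbb{E}$ consisting of the pairs $\langle x,y\rangle$ of nearest neighbours. An edge $\langle x,y\rangle$ is horizontal if $x_2=y_2$ and vertical if $x_1=y_1$. Given $\mathbf{p}=(p_h,p_v)\in[0,1]^2$, $\mathbb{P}_{\mathbf{p}}$ is the product probability measure on $\{0,1\}^{\mathbb{E}}$ (with the $\sigma$-algebra generated by cylinder sets) under which each horizontal edge is open (value $1$) with probability $p_h$, each vertical edge is open with probability $p_v$, and edges are otherwise closed (value $0$), all independently. An open cluster in a configuration $\omega$ is a connected subgraph $A=(V_A,E_A)$ of the square lattice such that $\omega(e)=1$ for all $e\in E_A$ and $\omega(e)=0$ for all $e\in\partial_e A=\{e\in\mathbb{E}: |e\cap V_A|=1\}$. The truncated connectivity function is $$\tau^{f}_{\mathbf{p}}(x,y)=\mathbb{P}_{\mathbf{p}}\big(\exists\text{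 open cluster }A:\ \{x,y\}\subset V_A,\ |E_A|<\infty\big),$$ and $0$ denotes the origin of $\mathbb{Z}^2$. The paper writes $\lambda_h=\frac{1-p_h}{p_h}$, $\lambda_v=\frac{1-p_v}{p_v}$, $\eta=\lambda_v/\lambda_h$. *)

theory Defs
  imports "HOL-Probability.Probability"
begin

type_synonym vertex = "int \<times> int"

text \<open>Edges are unordered pairs, i.e. two-element sets of vertices.\<close>

type_synonym edge = "vertex set"

definition edges :: "edge set" where
  "edges = {{x, y} | x y :: vertex. \<bar>fst x - fst y\<bar> + \<bar>snd x - snd y\<bar> = 1}"

definition horizontal :: "edge \<Rightarrow> bool" where
  "horizontal e \<longleftrightarrow> (\<forall>x\<in>e. \<forall>y\<in>e. snd x = snd y)"

text \<open>The parameter is the pair of the horizontal and the vertical edge density. Every edge that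
  is not horizontal is vertical. A configuration assigns \<^const>\<open>True\<close> to the open edges.\<close>

definition percolation :: "real \<times> real \<Rightarrow> (edge \<Rightarrow> bool) measure" where
  "percolation p =
     (\<Pi>\<^sub>M e\<in>edges. measure_pmf (bernoulli_pmf (if horizontal e then fst p else snd p)))"

definition subgraph :: "vertex set \<Rightarrow> edge set \<Rightarrow> bool" where
  "subgraph V E \<longleftrightarrow> E \<subseteq> edges \<and> \<Union>E \<subseteq> V"

definition connected_graph :: "vertex set \<Rightarrow> edge set \<Rightarrow> bool" where
  "connected_graph V E \<longleftrightarrow> (\<forall>u\<in>V. \<forall>v\<in>V. (u, v) \<in> {(a, b). {a, b} \<in> E}\<^sup>*)"

definition edge_boundary :: "vertex set \<Rightarrow> edge set" where
  "edge_boundary V = {e \<in> edges. card (e \<inter> V) = 1}"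

text \<open>An edge with both endpoints in \<open>V\<close> that does not belong to \<open>E\<close> may be open or closed.\<close>

definition open_cluster :: "(edge \<Rightarrow> bool) \<Rightarrow> vertex set \<Rightarrow> edge set \<Rightarrow> bool" where
  "open_cluster \<omega> V E \<longleftrightarrow> subgraph V E \<and> connected_graph V E
     \<and> (\<forall>e\<in>E. \<omega> e) \<and> (\<forall>e\<in>edge_boundary V. \<not> \<omega> e)"

definition truncated_connectivity :: "real \<times> real \<Rightarrow> vertex \<Rightarrow> vertex \<Rightarrow> real" where
  "truncated_connectivity p x y =
     measure (percolation p)
       {\<omega> \<in> space (percolation p). \<exists>V E. open_cluster \<omega> V E \<and> {x, y} \<subseteq> V \<and> finite E}"

end

theory Submission
  imports Defs
begin

text \<open>Fill the holes of the finite cluster of the origin to get a region \<open>W\<close> that is connected and has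
  connected complement. Its boundary, of length \<open>n\<close>, is closed; conversely, if the boundary is closed
  and a suitable connected set of at most \<open>22 n\<close> edges inside \<open>W\<close> is open, then the filled cluster is
  \<open>W\<close>. So, up to a factor \<open>p_h\<^sup>2\<^sup>2\<^sup>n\<close>, the truncated connectivity is the sum over all such regions
  of the probability that the boundary is closed. Let \<open>\<Delta> = x\<^sub>2 - x\<^sub>1\<close> and \<open>N = 2 (x\<^sub>1 + x\<^sub>2 + 2)\<close>, the
  length of the shortest boundaries. If \<open>n \<le> N + \<Delta>\<close>, a region containing \<open>x\<close> beats its reflection by a
  factor of about \<open>\<eta>\<^sup>-\<^sup>\<Delta>\<close>; as \<open>n = O(\<Delta>)\<close>, this absorbs \<open>p_h\<^sup>2\<^sup>2\<^sup>n\<close> for \<open>p_h\<close> near 1. The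
  longer boundaries are negligible against that of a rectangle, by a Peierls bound.\<close>

section \<open>The square lattice\<close>

definition adj :: "vertex \<Rightarrow> vertex \<Rightarrow> bool" where
  "adj a b \<longleftrightarrow> \<bar>fst a - fst b\<bar> + \<bar>snd a - snd b\<bar> = 1"

definition induced :: "vertex set \<Rightarrow> edge set" where
  "induced W = {e \<in> edges. e \<subseteq> W}"

abbreviation connected_set :: "vertex set \<Rightarrow> bool" where
  "connected_set W \<equiv> connected_graph W (induced W)"

lemma adj_commute: "adj a b \<longleftrightarrow> adj b a"
  by (auto simp: adj_def)

lemma adj_irrefl [simp]: "\<not> adj a a"
  by (auto simp: adj_def)

lemma adj_cases:
  assumes "adj p q"
  obtains x y where "p = (x, y)" "q = (x + 1, y)" | x y where "p = (x + 1, y)" "q = (x, y)"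
    | x y where "p = (x, y)" "q = (x, y + 1)" | x y where "p = (x, y + 1)" "q = (x, y)"
proof -
  obtain x y x' y' where xy: "p = (x, y)" "q = (x', y')" by (cases p, cases q)
  have "x' = x + 1 \<and> y' = y \<or> x = x' + 1 \<and> y' = y \<or> x' = x \<and> y' = y + 1 \<or> x' = x \<and> y = y' + 1"
    using assms unfolding xy adj_def fst_conv snd_conv by (smt (verit))
  then show thesis using that xy by blast
qed

lemma adj_near:
  assumes "adj a b"
  shows "\<bar>fst a - fst b\<bar> \<le> 1" "\<bar>snd a - snd b\<bar> \<le> 1"
  using assms unfolding adj_def by linarith+

lemma adj_simps [simp]:
  "adj (i, j) (i + 1, j)" "adj (i, j) (i, j + 1)" "adj (i + 1, j) (i, j)" "adj (i, j + 1) (i, j)"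
  by (auto simp: adj_def)

lemma edge_iff [simp]: "{a, b} \<in> edges \<longleftrightarrow> adj a b"
  by (cases a; cases b) (auto simp: edges_def adj_def doubleton_eq_iff abs_minus_commute)

lemma edgeE:
  assumes "e \<in> edges"
  obtains a b where "e = {a, b}" "adj a b"
  using assms by (auto simp: edges_def adj_def)

lemma induced_iff [simp]: "{a, b} \<in> induced W \<longleftrightarrow> adj a b \<and> a \<in> W \<and> b \<in> W"
  by (auto simp: induced_def)

lemma horizontal_iff [simp]: "horizontal {a, b} \<longleftrightarrow> snd a = snd b"
  by (auto simp: horizontal_def)

lemma card_doubleton_Int:
  assumes "a \<noteq> b"
  shows "card ({a, b} \<inter> W) = 1 \<longleftrightarrow> (a \<in> W) \<noteq> (b \<in> W)"
  using assms by (auto simp: Int_insert_left)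

lemma boundary_iff [simp]: "{a, b} \<in> edge_boundary W \<longleftrightarrow> adj a b \<and> (a \<in> W) \<noteq> (b \<in> W)"
proof (cases "a = b")
  case False
  then show ?thesis
    by (simp only: edge_boundary_def mem_Collect_eq edge_iff card_doubleton_Int not_False_eq_True)
qed (simp only: edge_boundary_def mem_Collect_eq edge_iff adj_irrefl simp_thms)

lemma boundaryE:
  assumes "e \<in> edge_boundary W"
  obtains a b where "e = {a, b}" "adj a b" "a \<in> W" "b \<notin> W"
proof -
  have "e \<in> edges" using assms by (simp add: edge_boundary_def)
  then obtain a b where e: "e = {a, b}" "adj a b" by (rule edgeE)
  with assms have "(a \<in> W) \<noteq> (b \<in> W)" by simp
  then show thesis
    using that[of a b] that[of b a] e by (auto simp: insert_commute adj_commute)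
qed

lemma countable_edges: "countable edges"
proof -
  have "edges \<subseteq> (\<lambda>(a, b). {a, b}) ` (UNIV :: (vertex \<times> vertex) set)"
    by (auto elim!: edgeE)
  then show ?thesis by (rule countable_subset) simp
qed

section \<open>Connected sets of vertices\<close>

text \<open>Connectivity is tested by truth-valued functions instead of paths: a set is connected
  exactly if every locally constant function on it is constant.\<close>

definition locally_constant :: "vertex set \<Rightarrow> (vertex \<Rightarrow> bool) \<Rightarrow> bool" where
  "locally_constant W f \<longleftrightarrow> (\<forall>u\<in>W. \<forall>v\<in>W. adj u v \<longrightarrow> f u = f v)"

lemma locally_constant_subset: "locally_constant W f \<Longrightarrow> V \<subseteq> W \<Longrightarrow> locally_constant V f"
  by (auto simp: locally_constant_def)

lemma connected_set_constant:
  assumes "connected_set W" "locally_constant W f" "u \<in> W" "v \<in> W"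
  shows "f u = f v"
proof -
  have "(u, v) \<in> {(a, b). {a, b} \<in> induced W}\<^sup>*"
    using assms by (auto simp: connected_graph_def)
  then show ?thesis
    by (induction rule: rtrancl_induct) (use assms(2) in \<open>auto simp: locally_constant_def\<close>)
qed

text \<open>Reachability from \<open>u\<close> inside \<open>W\<close> is itself locally constant
  and true at \<open>u\<close>, hence true at \<open>v\<close>.\<close>

lemma connected_setI:
  assumes "\<And>f u v. locally_constant W f \<Longrightarrow> u \<in> W \<Longrightarrow> v \<in> W \<Longrightarrow> f u = f v"
  shows "connected_set W"
  unfolding connected_graph_def
proof (intro ballI)
  fix u v assume uv: "u \<in> W" "v \<in> W"
  let ?R = "{(a, b). {a, b} \<in> induced W}"
  have "locally_constant W (\<lambda>w. (u, w) \<in> ?R\<^sup>*)"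
    unfolding locally_constant_def
  proof (intro ballI impI)
    fix a b assume "a \<in> W" "b \<in> W" "adj a b"
    then have "(a, b) \<in> ?R" "(b, a) \<in> ?R" by (auto simp: adj_commute)
    then show "((u, a) \<in> ?R\<^sup>*) = ((u, b) \<in> ?R\<^sup>*)"
      by (meson rtrancl.rtrancl_into_rtrancl)
  qed
  from assms[OF this uv] show "(u, v) \<in> ?R\<^sup>*" by auto
qed

lemma connected_set_Un:
  assumes "connected_set A" "connected_set B" "A \<inter> B \<noteq> {}"
  shows "connected_set (A \<union> B)"
proof (rule connected_setI)
  fix f u v assume f: "locally_constant (A \<union> B) f" and uv: "u \<in> A \<union> B" "v \<in> A \<union> B"
  obtain w where w: "w \<in> A" "w \<in> B" using assms(3) by auto
  have "f z = f w" if "z \<in> A \<union> B" for z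
    using that connected_set_constant[OF assms(1), of f z w] w
      connected_set_constant[OF assms(2), of f z w] f
    by (auto intro: locally_constant_subset)
  with uv show "f u = f v" by auto
qed

lemma locally_constant_line:
  fixes \<gamma> :: "int \<Rightarrow> vertex"
  assumes "locally_constant W f" "\<And>i. adj (\<gamma> i) (\<gamma> (i + 1))"
    and "\<And>k. i \<le> k \<Longrightarrow> k \<le> j \<Longrightarrow> \<gamma> k \<in> W" "i \<le> j"
  shows "f (\<gamma> i) = f (\<gamma> j)"
  using assms(4,3)
proof (induction j rule: int_ge_induct)
  case (step k)
  have "f (\<gamma> k) = f (\<gamma> (k + 1))"
    using step assms(1,2) by (auto simp: locally_constant_def)
  with step show ?case by auto
qed auto

section \<open>Rows, columns and rectangles\<close>

lemma locally_constant_row: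
  assumes "locally_constant W f" "\<And>k. min i j \<le> k \<Longrightarrow> k \<le> max i j \<Longrightarrow> (k, y) \<in> W"
  shows "f (i, y) = f (j, y)"
proof (cases "i \<le> j")
  case True
  then show ?thesis
    using locally_constant_line[OF assms(1), of "\<lambda>k. (k, y)" i j] assms(2) by simp
next
  case False
  then show ?thesis
    using locally_constant_line[OF assms(1), of "\<lambda>k. (k, y)" j i] assms(2) by simp
qed

lemma locally_constant_column:
  assumes "locally_constant W f" "\<And>k. min i j \<le> k \<Longrightarrow> k \<le> max i j \<Longrightarrow> (x, k) \<in> W"
  shows "f (x, i) = f (x, j)"
proof (cases "i \<le> j")
  case True
  then show ?thesis
    using locally_constant_line[OF assms(1), of "\<lambda>k. (x, k)" i j] assms(2) by simp
next
  case False
  then show ?thesis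
    using locally_constant_line[OF assms(1), of "\<lambda>k. (x, k)" j i] assms(2) by simp
qed

lemma connected_rectangle: "connected_set ({a..b} \<times> {c..d})"
proof (rule connected_setI)
  fix f u v assume f: "locally_constant ({a..b} \<times> {c..d}) f"
    and uv: "u \<in> {a..b} \<times> {c..d}" "v \<in> {a..b} \<times> {c..d}"
  have "f (fst u, snd u) = f (fst v, snd u)"
    by (rule locally_constant_row[OF f]) (use uv in auto)
  also have "\<dots> = f (fst v, snd v)"
    by (rule locally_constant_column[OF f]) (use uv in auto)
  finally show "f u = f v" by simp
qed

text \<open>Every outside point lies on a full row or a full column that avoids the rectangle; such
  lines link it to the corner \<open>(b + 1, d + 1)\<close>.\<close>

lemma connected_Compl_rectangle: "connected_set (- ({a..b} \<times> {c..d}))"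
proof (rule connected_setI)
  fix f u v assume f: "locally_constant (- ({a..b} \<times> {c..d})) f"
    and uv: "u \<in> - ({a..b} \<times> {c..d})" "v \<in> - ({a..b} \<times> {c..d})"
  have row: "f (i, y) = f (j, y)" if "y \<notin> {c..d}" for i j y
    by (rule locally_constant_row[OF f]) (use that in auto)
  have col: "f (x, i) = f (x, j)" if "x \<notin> {a..b}" for i j x
    by (rule locally_constant_column[OF f]) (use that in auto)
  have "f (x, y) = f (b + 1, d + 1)" if "(x, y) \<notin> {a..b} \<times> {c..d}" for x y
  proof (cases "y \<in> {c..d}")
    case True
    then show ?thesis using that col[of x y "d + 1"] row[of "d + 1" x "b + 1"] by auto
  next
    case False
    then show ?thesis using row[of y x "b + 1"] col[of "b + 1" y "d + 1"] by auto
  qed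
  with uv show "f u = f v" by (metis ComplD prod.collapse)
qed

lemma connected_UNIV: "connected_set UNIV"
  using connected_Compl_rectangle[of 1 0 1 0] by simp

lemma connected_set_swap:
  assumes "connected_set W"
  shows "connected_set (prod.swap ` W)"
proof (rule connected_setI)
  fix f u v assume f: "locally_constant (prod.swap ` W) f" and "u \<in> prod.swap ` W" "v \<in> prod.swap ` W"
  then obtain u' v' where uv: "u = prod.swap u'" "v = prod.swap v'" "u' \<in> W" "v' \<in> W"
    by (elim imageE)
  have "locally_constant W (f \<circ> prod.swap)"
    unfolding locally_constant_def
  proof (intro ballI impI)
    fix a b assume "a \<in> W" "b \<in> W" "adj a b"
    then have "prod.swap a \<in> prod.swap ` W" "prod.swap b \<in> prod.swap ` W"
      "adj (prod.swap a) (prod.swap b)" by (simp_all add: adj_def)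
    with f show "(f \<circ> prod.swap) a = (f \<circ> prod.swap) b" unfolding locally_constant_def comp_def by blast
  qed
  from connected_set_constant[OF assms this uv(3,4)] uv show "f u = f v" by simp
qed

section \<open>The boundary of a finite set\<close>

abbreviation hboundary :: "vertex set \<Rightarrow> edge set" where
  "hboundary W \<equiv> {e \<in> edge_boundary W. horizontal e}"

abbreviation vboundary :: "vertex set \<Rightarrow> edge set" where
  "vboundary W \<equiv> {e \<in> edge_boundary W. \<not> horizontal e}"

lemma finite_boundary:
  assumes "finite W"
  shows "finite (edge_boundary W)"
proof -
  let ?N = "\<lambda>a::vertex. {fst a - 1..fst a + 1} \<times> {snd a - 1..snd a + 1}"
  have "edge_boundary W \<subseteq> (\<lambda>(a, b). {a, b}) ` (SIGMA a:W. ?N a)"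
  proof
    fix e assume "e \<in> edge_boundary W"
    then obtain a b where ab: "e = {a, b}" "adj a b" "a \<in> W" "b \<notin> W" by (rule boundaryE)
    have "b \<in> ?N a" using adj_near[OF ab(2)] by (cases b) auto
    with ab(1,3) show "e \<in> (\<lambda>(a, b). {a, b}) ` (SIGMA a:W. ?N a)"
      by (intro image_eqI[of _ _ "(a, b)"] SigmaI) simp_all
  qed
  moreover have "finite (SIGMA a:W. ?N a)" using assms by auto
  ultimately show ?thesis by (meson finite_imageI finite_subset)
qed

lemma card_boundary:
  assumes "finite W"
  shows "card (edge_boundary W) = card (hboundary W) + card (vboundary W)"
proof -
  have "edge_boundary W = hboundary W \<union> vboundary W" by auto
  then show ?thesis
    using card_Un_disjoint[of "hboundary W" "vboundary W"] finite_boundary[OF assms] by auto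
qed

lemma swap_swap_image [simp]: "prod.swap ` prod.swap ` A = A"
  by (simp add: image_image)

lemma swap_boundary:
  assumes "e \<in> edge_boundary W"
  shows "prod.swap ` e \<in> edge_boundary (prod.swap ` W)"
    and "horizontal (prod.swap ` e) \<longleftrightarrow> \<not> horizontal e"
proof -
  obtain a b where e: "e = {a, b}" "adj a b" "a \<in> W" "b \<notin> W" using assms by (rule boundaryE)
  then have "adj (prod.swap a) (prod.swap b)" "prod.swap a \<in> prod.swap ` W" "prod.swap b \<notin> prod.swap ` W"
    by (simp_all add: adj_def inj_image_mem_iff)
  with e show "prod.swap ` e \<in> edge_boundary (prod.swap ` W)"
    "horizontal (prod.swap ` e) \<longleftrightarrow> \<not> horizontal e" by (auto simp: adj_def)
qed

lemma card_boundary_swap_le: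
  assumes "finite W"
  shows "card (hboundary W) \<le> card (vboundary (prod.swap ` W))"
    and "card (vboundary W) \<le> card (hboundary (prod.swap ` W))"
proof -
  have inj: "inj_on ((`) prod.swap) A" for A :: "edge set"
    by (rule inj_on_inverseI[where g = "(`) prod.swap"]) simp
  have fin: "finite (vboundary (prod.swap ` W))" "finite (hboundary (prod.swap ` W))"
    using assms by (simp_all add: finite_boundary)
  show "card (hboundary W) \<le> card (vboundary (prod.swap ` W))"
    by (rule card_inj_on_le[OF inj _ fin(1)]) (clarsimp simp: swap_boundary)
  show "card (vboundary W) \<le> card (hboundary (prod.swap ` W))"
    by (rule card_inj_on_le[OF inj _ fin(2)]) (clarsimp simp: swap_boundary)
qed

lemma card_boundary_swap:
  assumes "finite W"
  shows "card (vboundary (prod.swap ` W)) = card (hboundary W)"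
    and "card (hboundary (prod.swap ` W)) = card (vboundary W)"
  using card_boundary_swap_le[OF assms] card_boundary_swap_le[of "prod.swap ` W"] assms
  by (simp_all add: order_antisym)

text \<open>In each occupied column the edge leaving \<open>W\<close> above its highest vertex and
  the one below its lowest vertex are two distinct vertical boundary edges; \<open>\<phi>\<close>
  enumerates them injectively.\<close>

lemma card_vboundary_ge:
  assumes "finite W"
  shows "2 * card (fst ` W) \<le> card (vboundary W)"
proof -
  define Y where "Y i = {y. (i, y) \<in> W}" for i
  have fin: "finite (Y i)" for i
  proof -
    have "Y i \<subseteq> snd ` W" by (force simp: Y_def)
    then show ?thesis using assms by (meson finite_imageI finite_subset)
  qed
  define \<phi> where "\<phi> = (\<lambda>(i, b). if b then {(i, Max (Y i)), (i, Max (Y i) + 1)}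
    else {(i, Min (Y i) - 1), (i, Min (Y i))})"
  have ne: "Y i \<noteq> {}" if "i \<in> fst ` W" for i using that by (auto simp: Y_def)
  have Max: "(i, Max (Y i)) \<in> W" "(i, Min (Y i)) \<in> W" if "i \<in> fst ` W" for i
    using Max_in[OF fin ne[OF that]] Min_in[OF fin ne[OF that]] by (auto simp: Y_def)
  have out: "(i, Max (Y i) + 1) \<notin> W" "(i, Min (Y i) - 1) \<notin> W" for i
    using Max_ge[OF fin, of "Max (Y i) + 1" i] Min_le[OF fin, of "Min (Y i) - 1" i]
    by (auto simp: Y_def)
  have le: "Min (Y i) \<le> Max (Y i)" if "i \<in> fst ` W" for i
    using ne[OF that] fin by (meson Max_ge Min_in)
  have "card (fst ` W \<times> (UNIV :: bool set)) \<le> card (vboundary W)"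
  proof (rule card_inj_on_le)
    show "inj_on \<phi> (fst ` W \<times> UNIV)"
    proof (rule inj_onI)
      fix s t assume st: "s \<in> fst ` W \<times> (UNIV :: bool set)" "t \<in> fst ` W \<times> (UNIV :: bool set)" "\<phi> s = \<phi> t"
      obtain i b j c where s: "s = (i, b)" "t = (j, c)" by (cases s, cases t)
      have "i \<in> fst ` W" "j \<in> fst ` W" using st s by auto
      with le[of i] le[of j] st(3) show "s = t"
        by (auto simp: s \<phi>_def doubleton_eq_iff split: if_splits)
    qed
    show "\<phi> ` (fst ` W \<times> UNIV) \<subseteq> vboundary W"
    proof clarsimp
      fix i y b assume "(i, y) \<in> W"
      then have "i \<in> fst ` W" by force
      then show "\<phi> (i, b) \<in> edge_boundary W \<and> \<not> horizontal (\<phi> (i, b))"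
        using Max[of i] out[of i] by (auto simp: \<phi>_def adj_def)
    qed
  qed (simp add: finite_boundary assms)
  then show ?thesis by (simp add: card_cartesian_product)
qed

lemma card_hboundary_ge:
  assumes "finite W"
  shows "2 * card (snd ` W) \<le> card (hboundary W)"
  using card_vboundary_ge[of "prod.swap ` W"] assms
  by (simp add: card_boundary_swap image_image)

text \<open>If column \<open>k\<close> were missing, lying to its left would be a locally constant
  property, because a lattice step cannot jump over a column.\<close>

lemma connected_set_fst_convex:
  assumes "connected_set W" "u \<in> W" "v \<in> W"
  shows "{fst u..fst v} \<subseteq> fst ` W"
proof
  fix k assume k: "k \<in> {fst u..fst v}"
  show "k \<in> fst ` W"
  proof (rule ccontr)
    assume *: "k \<notin> fst ` W"
    have "locally_constant W (\<lambda>w. fst w < k)"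
      unfolding locally_constant_def
    proof (intro ballI impI)
      fix a b assume ab: "a \<in> W" "b \<in> W" "adj a b"
      have "fst a \<noteq> k" "fst b \<noteq> k" using ab * by auto
      with ab(3) show "(fst a < k) = (fst b < k)" by (auto simp: adj_def)
    qed
    from connected_set_constant[OF assms(1) this assms(2,3)] k
    have "fst u = k" by auto
    with * assms(2) show False by auto
  qed
qed

lemma connected_set_snd_convex:
  assumes "connected_set W" "u \<in> W" "v \<in> W"
  shows "{snd u..snd v} \<subseteq> snd ` W"
  using connected_set_fst_convex[OF connected_set_swap[OF assms(1)], of "prod.swap u" "prod.swap v"]
    assms(2,3) by (simp add: image_image)

lemma card_boundary_rectangle:
  assumes "a \<le> b" "c \<le> d"
  shows "card (edge_boundary ({a..b} \<times> {c..d})) \<le> nat (2 * (b - a + 1) + 2 * (d - c + 1))"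
proof -
  let ?L = "(\<lambda>y. {(a - 1, y), (a, y)}) ` {c..d}" and ?R = "(\<lambda>y. {(b + 1, y), (b, y)}) ` {c..d}"
  let ?B = "(\<lambda>x. {(x, c - 1), (x, c)}) ` {a..b}" and ?T = "(\<lambda>x. {(x, d + 1), (x, d)}) ` {a..b}"
  have "edge_boundary ({a..b} \<times> {c..d}) \<subseteq> (?L \<union> ?R) \<union> (?B \<union> ?T)"
  proof
    fix e assume "e \<in> edge_boundary ({a..b} \<times> {c..d})"
    then obtain u w where e: "e = {u, w}" "adj u w" "u \<in> {a..b} \<times> {c..d}" "w \<notin> {a..b} \<times> {c..d}"
      by (rule boundaryE)
    obtain x y x' y' where uw: "u = (x, y)" "w = (x', y')" by (cases u, cases w)
    consider "x' = a - 1" "x = a" "y' = y" | "x' = b + 1" "x = b" "y' = y"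
      | "y' = c - 1" "y = c" "x' = x" | "y' = d + 1" "y = d" "x' = x"
      using e(2-4) by (auto simp: uw adj_def abs_if split: if_splits)
    then show "e \<in> (?L \<union> ?R) \<union> (?B \<union> ?T)"
      by cases (use e in \<open>auto simp: uw insert_commute\<close>)
  qed
  then have "card (edge_boundary ({a..b} \<times> {c..d})) \<le> card ((?L \<union> ?R) \<union> (?B \<union> ?T))"
    by (intro card_mono) auto
  also have "\<dots> \<le> (card ?L + card ?R) + (card ?B + card ?T)"
    by (meson add_mono card_Un_le order_trans)
  also have "\<dots> \<le> (card {c..d} + card {c..d}) + (card {a..b} + card {a..b})"
    by (intro add_mono card_image_le) auto
  also have "\<dots> = nat (2 * (b - a + 1) + 2 * (d - c + 1))" using assms by simp
  finally show ?thesis .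
qed

section \<open>Skeletons\<close>

text \<open>\<open>G i\<close> is the parity of the number of points between 0 and \<open>i\<close>
  at which \<open>s\<close> holds. The intervals are half-open on the right for both signs of
  \<open>i\<close>, so that a step from \<open>i\<close> to \<open>i + 1\<close> changes the count
  exactly at \<open>i\<close>.\<close>

lemma parity_antiderivative:
  fixes s :: "int \<Rightarrow> bool"
  obtains G where "\<not> G 0" "\<And>i. G (i + 1) \<longleftrightarrow> G i \<noteq> s i"
proof -
  define S where "S i = {j. s j \<and> (0 \<le> j \<and> j < i \<or> i \<le> j \<and> j < 0)}" for i :: int
  have fin: "finite (S i)" for i
    by (rule finite_subset[of _ "{0..i} \<union> {i..0}"]) (auto simp: S_def)
  have "S 0 = {}" by (auto simp: S_def)
  then have zero: "\<not> odd (card (S 0))" by simp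
  have step: "odd (card (S (i + 1))) \<longleftrightarrow> odd (card (S i)) \<noteq> s i" for i
  proof (cases "0 \<le> i")
    case True
    then have "S (i + 1) = (if s i then insert i (S i) else S i)" "i \<notin> S i"
      by (auto simp: S_def order_le_less)
    then show ?thesis using fin by simp
  next
    case False
    then have "S i = (if s i then insert i (S (i + 1)) else S (i + 1))" "i \<notin> S (i + 1)"
      by (auto simp: S_def order_le_less)
    then show ?thesis using fin by simp
  qed
  from that[of "\<lambda>i. odd (card (S i))", OF zero step] show thesis .
qed

text \<open>The discrete Poincare lemma modulo 2: a set of edges that meets every plaquette in an
  even number of edges is a coboundary. The potential is obtained by integrating along the row
  \<open>y = 0\<close> and then along columns.\<close>

lemma parity_potential:
  fixes h k :: "int \<Rightarrow> int \<Rightarrow> bool"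
  assumes plaquette: "\<And>x y. (h x y \<noteq> k (x + 1) y) \<longleftrightarrow> (k x y \<noteq> h x (y + 1))"
  obtains g :: "vertex \<Rightarrow> bool"
  where "\<And>x y. g (x + 1, y) \<longleftrightarrow> g (x, y) \<noteq> h x y" "\<And>x y. g (x, y + 1) \<longleftrightarrow> g (x, y) \<noteq> k x y"
proof -
  obtain H where H: "\<And>x. H (x + 1) \<longleftrightarrow> H x \<noteq> h x 0"
    using parity_antiderivative[of "\<lambda>x. h x 0"] by metis
  have "\<forall>x. \<exists>K. \<not> K 0 \<and> (\<forall>y. K (y + 1) \<longleftrightarrow> K y \<noteq> k x y)"
    using parity_antiderivative by metis
  then obtain K where K: "\<And>x. \<not> K x 0" "\<And>x y. K x (y + 1) \<longleftrightarrow> K x y \<noteq> k x y"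
    by metis
  \<comment> \<open>Vertical increments are right by construction. The horizontal ones are right in
    row 0, and the plaquette condition carries them from row to row in both directions.\<close>
  have horizontal: "\<forall>x. (K (x + 1) y \<noteq> h x 0) \<longleftrightarrow> (K x y \<noteq> h x y)" for y
  proof (induction y rule: int_induct[where k = 0])
    case base
    show ?case using K(1) by simp
  next
    case (step1 y)
    then show ?case using K(2)[of _ y] plaquette[of _ y] by metis
  next
    case (step2 y)
    then show ?case using K(2)[of _ "y - 1"] plaquette[of _ "y - 1"] by (simp, metis)
  qed
  show thesis
  proof (rule that[of "\<lambda>(x, y). H x \<noteq> K x y"])
    fix x y
    show "(\<lambda>(x, y). H x \<noteq> K x y) (x + 1, y) \<longleftrightarrow> (\<lambda>(x, y). H x \<noteq> K x y) (x, y) \<noteq> h x y"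
      using H[of x] horizontal[rule_format, of x y] by auto
    show "(\<lambda>(x, y). H x \<noteq> K x y) (x, y + 1) \<longleftrightarrow> (\<lambda>(x, y). H x \<noteq> K x y) (x, y) \<noteq> k x y"
      using K(2)[of x y] by auto
  qed
qed

section \<open>The layer along the boundary\<close>

definition inner_boundary :: "vertex set \<Rightarrow> vertex set" where
  "inner_boundary W = {u \<in> W. \<exists>w. w \<notin> W \<and> adj u w}"

text \<open>Diagonal contact with the complement counts as well: at reentrant corners the inner
  boundary can break into pieces that touch only diagonally.\<close>

definition layer :: "vertex set \<Rightarrow> vertex set" where
  "layer W = {u \<in> W. \<exists>w. w \<notin> W \<and> \<bar>fst u - fst w\<bar> \<le> 1 \<and> \<bar>snd u - snd w\<bar> \<le> 1}"

lemma inner_boundary_subset_layer: "inner_boundary W \<subseteq> layer W"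
  unfolding inner_boundary_def layer_def using adj_near by blast

lemma layer_near_inner_boundary:
  assumes "u \<in> layer W"
  obtains "u \<in> inner_boundary W"
  | z where "z \<in> inner_boundary W" "adj u z"
proof (cases "u \<in> inner_boundary W")
  case False
  obtain w where w: "u \<in> W" "w \<notin> W" "\<bar>fst u - fst w\<bar> \<le> 1" "\<bar>snd u - snd w\<bar> \<le> 1"
    using assms by (auto simp: layer_def)
  have "\<not> adj u w" using False w unfolding inner_boundary_def by blast
  moreover have "u \<noteq> w" using w by auto
  ultimately have diag: "\<bar>fst u - fst w\<bar> = 1" "\<bar>snd u - snd w\<bar> = 1"
    using w(3,4) by (auto simp: adj_def prod_eq_iff abs_if split: if_splits)
  \<comment> \<open>\<open>z\<close> is a common neighbour of \<open>u\<close> and the diagonal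
    vertex \<open>w\<close>. As \<open>u\<close> is not in the inner boundary, \<open>z\<close>
    belongs to \<open>W\<close>, and \<open>w\<close> puts it into the inner boundary.\<close>
  define z where "z = (fst u, snd w)"
  have z: "adj u z" "adj z w" using diag by (auto simp: z_def adj_def)
  with False w have "z \<in> inner_boundary W" unfolding inner_boundary_def by blast
  with z that(2) show thesis by blast
qed

text \<open>If \<open>f\<close> is locally constant on the layer, then the boundary edges whose inner endpoint satisfies
  \<open>f\<close> meet every plaquette in an even number of edges. Hence they form a coboundary; since \<open>W\<close> and
  its complement are connected, they are all of the boundary or none of it.\<close>

lemma connected_layer:
  assumes W: "connected_set W" and cW: "connected_set (- W)"
  shows "connected_set (layer W)"
proof (rule connected_setI)
  fix f u v assume f: "locally_constant (layer W) f" and uv: "u \<in> layer W" "v \<in> layer W"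
  define c where "c a b \<longleftrightarrow> (a \<in> W) \<noteq> (b \<in> W) \<and> f (if a \<in> W then a else b)" for a b
  have sym: "c a b = c b a" for a b by (auto simp: c_def)
  \<comment> \<open>On a plaquette that meets both \<open>W\<close> and its complement, the vertices
    of \<open>W\<close> form arcs in the layer. Each arc has constant \<open>f\<close> and ends in
    two boundary edges, which \<open>c\<close> therefore selects together or not at all.\<close>
  have even: "(c (x, y) (x + 1, y) \<noteq> c (x + 1, y) (x + 1, y + 1)) \<longleftrightarrow>
    (c (x, y) (x, y + 1) \<noteq> c (x, y + 1) (x + 1, y + 1))" for x y
  proof -
    let ?P = "{(x, y), (x + 1, y), (x, y + 1), (x + 1, y + 1)}"
    have *: "f p = f q" if "p \<in> ?P" "q \<in> ?P" "r \<in> ?P" "p \<in> W" "q \<in> W" "r \<notin> W" "adj p q" for p q r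
    proof -
      have "\<bar>fst p - fst r\<bar> \<le> 1 \<and> \<bar>snd p - snd r\<bar> \<le> 1 \<and> \<bar>fst q - fst r\<bar> \<le> 1 \<and> \<bar>snd q - snd r\<bar> \<le> 1"
        using that(1-3) by auto
      then have "p \<in> layer W" "q \<in> layer W" using that unfolding layer_def by blast+
      with f that(7) show ?thesis by (auto simp: locally_constant_def)
    qed
    define a b d e where abde: "a = (x, y)" "b = (x + 1, y)" "d = (x, y + 1)" "e = (x + 1, y + 1)"
    have adj: "adj a b" "adj b e" "adj a d" "adj d e" by (auto simp: abde)
    have "a \<in> W \<Longrightarrow> b \<in> W \<Longrightarrow> d \<notin> W \<or> e \<notin> W \<Longrightarrow> f a = f b"
      "b \<in> W \<Longrightarrow> e \<in> W \<Longrightarrow> a \<notin> W \<or> d \<notin> W \<Longrightarrow> f b = f e"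
      "a \<in> W \<Longrightarrow> d \<in> W \<Longrightarrow> b \<notin> W \<or> e \<notin> W \<Longrightarrow> f a = f d"
      "d \<in> W \<Longrightarrow> e \<in> W \<Longrightarrow> a \<notin> W \<or> b \<notin> W \<Longrightarrow> f d = f e"
      using *[folded abde] adj by blast+
    then show ?thesis
      unfolding abde[symmetric] c_def by (cases "a \<in> W"; cases "b \<in> W"; cases "d \<in> W"; cases "e \<in> W") simp_all
  qed
  obtain g where g: "\<And>x y. g (x + 1, y) \<longleftrightarrow> g (x, y) \<noteq> c (x, y) (x + 1, y)"
    "\<And>x y. g (x, y + 1) \<longleftrightarrow> g (x, y) \<noteq> c (x, y) (x, y + 1)"
    by (rule parity_potential[of "\<lambda>x y. c (x, y) (x + 1, y)" "\<lambda>x y. c (x, y) (x, y + 1)", OF even]) (rule that)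
  have gc: "(g p \<noteq> g q) \<longleftrightarrow> c p q" if "adj p q" for p q
    using that
  proof (cases rule: adj_cases)
    case (1 x y)
    then show ?thesis using g(1)[of x y] by auto
  next
    case (2 x y)
    then show ?thesis using g(1)[of x y] sym[of p q] by auto
  next
    case (3 x y)
    then show ?thesis using g(2)[of x y] by auto
  next
    case (4 x y)
    then show ?thesis using g(2)[of x y] sym[of p q] by auto
  qed
  have "locally_constant W g" "locally_constant (- W) g"
    unfolding locally_constant_def using gc by (auto simp: c_def)
  note const = connected_set_constant[OF W this(1)] connected_set_constant[OF cW this(2)]
  \<comment> \<open>\<open>g\<close> has one value on \<open>W\<close> and one on the complement,
    and these differ exactly if \<open>f\<close> holds at the inner endpoint of a boundary
    edge.\<close>
  have inner: "f p = f q" if pq: "p \<in> inner_boundary W" "q \<in> inner_boundary W" for p q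
  proof -
    obtain p' q' where *: "p \<in> W" "p' \<notin> W" "adj p p'" "q \<in> W" "q' \<notin> W" "adj q q'"
      using pq unfolding inner_boundary_def by blast
    then have "f p \<longleftrightarrow> g p \<noteq> g p'" "f q \<longleftrightarrow> g q \<noteq> g q'"
      using gc[OF *(3)] gc[OF *(6)] by (simp_all add: c_def)
    moreover have "g p = g q" using * by (intro const(1))
    moreover have "g p' = g q'" using * by (intro const(2)) simp_all
    ultimately show ?thesis by simp
  qed
  have reduce: "\<exists>z \<in> inner_boundary W. f w = f z" if "w \<in> layer W" for w
    using that
  proof (cases rule: layer_near_inner_boundary)
    case (2 z)
    then have "f w = f z"
      using f that inner_boundary_subset_layer[of W] unfolding locally_constant_def by blast
    with 2 show ?thesis by blast
  qed auto
  from uv reduce inner show "f u = f v" by metis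
qed

text \<open>A vertex of the inner boundary is the only inner endpoint of some boundary edge, so it
  can be recovered from that edge.\<close>

lemma card_inner_boundary:
  assumes "finite W"
  shows "card (inner_boundary W) \<le> card (edge_boundary W)"
proof -
  have "inner_boundary W \<subseteq> (\<lambda>e. the_elem (e \<inter> W)) ` edge_boundary W"
  proof
    fix u assume "u \<in> inner_boundary W"
    then obtain w where w: "u \<in> W" "w \<notin> W" "adj u w" by (auto simp: inner_boundary_def)
    then have "{u, w} \<inter> W = {u}" by auto
    then have "u = the_elem ({u, w} \<inter> W)" by simp
    with w show "u \<in> (\<lambda>e. the_elem (e \<inter> W)) ` edge_boundary W" by (intro image_eqI[where x = "{u, w}"]) auto
  qed
  then show ?thesis using finite_boundary[OF assms] by (rule surj_card_le[rotated])
qed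

text \<open>The layer is covered by the 3 by 3 blocks around the vertices of the inner
  boundary.\<close>

lemma card_layer:
  assumes "finite W"
  shows "card (layer W) \<le> 9 * card (edge_boundary W)"
proof -
  let ?N = "\<lambda>z::vertex. {fst z - 1..fst z + 1} \<times> {snd z - 1..snd z + 1}"
  have fin: "finite (inner_boundary W)" using assms by (auto simp: inner_boundary_def)
  have "layer W \<subseteq> (\<Union>z\<in>inner_boundary W. ?N z)"
  proof
    fix u assume "u \<in> layer W"
    then show "u \<in> (\<Union>z\<in>inner_boundary W. ?N z)"
    proof (cases rule: layer_near_inner_boundary)
      case 1
      have "u \<in> ?N u" by (cases u) simp
      with 1 show ?thesis by (rule UN_I)
    next
      case (2 z)
      have "u \<in> ?N z" using adj_near[OF 2(2)] by (cases u) auto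
      with 2(1) show ?thesis by (rule UN_I)
    qed
  qed
  then have "card (layer W) \<le> card (\<Union>z\<in>inner_boundary W. ?N z)"
    using fin by (intro card_mono) auto
  also have "\<dots> \<le> (\<Sum>z\<in>inner_boundary W. card (?N z))" by (rule card_UN_le[OF fin])
  also have "\<dots> = 9 * card (inner_boundary W)" by (simp add: card_cartesian_product)
  finally show ?thesis using card_inner_boundary[OF assms] by linarith
qed

text \<open>Each edge is charged to its left or lower endpoint, and a vertex is charged at most
  twice.\<close>

lemma card_induced:
  assumes "finite D"
  shows "card (induced D) \<le> 2 * card D" and "finite (induced D)"
proof -
  let ?R = "(\<lambda>(x, y). {(x, y), (x + 1, y)}) ` D" and ?U = "(\<lambda>(x, y). {(x, y), (x, y + 1)}) ` D"
  have sub: "induced D \<subseteq> ?R \<union> ?U"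
  proof
    fix e assume e: "e \<in> induced D"
    then obtain p q where pq: "e = {p, q}" "adj p q" by (auto simp: induced_def elim: edgeE)
    have D: "p \<in> D" "q \<in> D" using e pq by auto
    from pq(2) show "e \<in> ?R \<union> ?U"
    proof (cases rule: adj_cases)
      case (1 x y)
      then show ?thesis using D pq(1) by (intro UnI1 image_eqI[of _ _ "(x, y)"]) auto
    next
      case (2 x y)
      then show ?thesis using D pq(1) by (intro UnI1 image_eqI[of _ _ "(x, y)"]) auto
    next
      case (3 x y)
      then show ?thesis using D pq(1) by (intro UnI2 image_eqI[of _ _ "(x, y)"]) auto
    next
      case (4 x y)
      then show ?thesis using D pq(1) by (intro UnI2 image_eqI[of _ _ "(x, y)"]) auto
    qed
  qed
  with assms show "finite (induced D)" by (meson finite_UnI finite_imageI finite_subset)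
  have "card (induced D) \<le> card (?R \<union> ?U)" using sub assms by (intro card_mono) auto
  also have "\<dots> \<le> card ?R + card ?U" by (rule card_Un_le)
  also have "\<dots> \<le> card D + card D" by (intro add_mono card_image_le assms)
  finally show "card (induced D) \<le> 2 * card D" by simp
qed

text \<open>Walk left from \<open>u\<close> up to the last vertex before the first exit from
  \<open>W\<close>. That vertex is in the layer, and the segment has at most one vertex in each
  column.\<close>

lemma segment_to_layer:
  assumes "finite W" "u \<in> W"
  obtains L where "L \<subseteq> W" "connected_set L" "u \<in> L" "L \<inter> layer W \<noteq> {}" "card L \<le> card (fst ` W)"
proof -
  define out where "out n \<longleftrightarrow> (fst u - int n, snd u) \<notin> W" for n
  have "\<exists>n. out n"
  proof (rule ccontr)
    assume "\<not> ?thesis"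
    then have "range (\<lambda>n. (fst u - int n, snd u)) \<subseteq> W" by (auto simp: out_def)
    moreover have "inj (\<lambda>n. (fst u - int n, snd u))" by (auto simp: inj_def)
    ultimately show False using assms(1) by (meson finite_imageD finite_subset infinite_UNIV_nat)
  qed
  then have n: "out (LEAST n. out n)" by (rule LeastI_ex)
  define n where "n = (LEAST n. out n)"
  have le: "\<not> out m" if "m < n" for m using that not_less_Least by (auto simp: n_def)
  have "n \<noteq> 0" using n assms(2) unfolding n_def[symmetric] by (intro notI) (simp add: out_def)
  define L where "L = {fst u - int n + 1..fst u} \<times> {snd u..snd u}"
  have "(k, snd u) \<in> W" if "k \<in> {fst u - int n + 1..fst u}" for k
    using le[of "nat (fst u - k)"] that by (auto simp: out_def)
  then have LW: "L \<subseteq> W" by (auto simp: L_def)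
  let ?z = "(fst u - int n + 1, snd u)"
  have z: "?z \<in> L" using \<open>n \<noteq> 0\<close> by (auto simp: L_def)
  moreover have "?z \<in> layer W"
  proof -
    have "(fst u - int n, snd u) \<notin> W" using n by (simp add: n_def out_def)
    then show ?thesis
      unfolding layer_def mem_Collect_eq using LW z
      by (intro conjI exI[of _ "(fst u - int n, snd u)"]) auto
  qed
  ultimately have "L \<inter> layer W \<noteq> {}" by blast
  moreover have "u \<in> L" using \<open>n \<noteq> 0\<close> by (cases u) (auto simp: L_def)
  moreover have "card L \<le> card (fst ` W)"
  proof -
    have "inj_on fst L" by (auto simp: L_def inj_on_def)
    then have "card L = card (fst ` L)" by (simp add: card_image)
    also have "\<dots> \<le> card (fst ` W)" using LW assms(1) by (intro card_mono) auto
    finally show ?thesis .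
  qed
  moreover have "connected_set L" unfolding L_def by (rule connected_rectangle)
  ultimately show thesis using that LW by blast
qed

lemma skeleton_exists:
  assumes "finite W" "connected_set W" "connected_set (- W)" "u \<in> W" "v \<in> W"
  obtains D where "D \<subseteq> W" "connected_set D" "u \<in> D" "v \<in> D" "inner_boundary W \<subseteq> D"
    "card (induced D) \<le> 22 * card (edge_boundary W)"
proof -
  obtain L where L: "L \<subseteq> W" "connected_set L" "u \<in> L" "L \<inter> layer W \<noteq> {}" "card L \<le> card (fst ` W)"
    using segment_to_layer[OF assms(1,4)] by blast
  obtain L' where L': "L' \<subseteq> W" "connected_set L'" "v \<in> L'" "L' \<inter> layer W \<noteq> {}"
    "card L' \<le> card (fst ` W)"
    using segment_to_layer[OF assms(1,5)] by blast
  have lW: "layer W \<subseteq> W" by (auto simp: layer_def)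
  define D where "D = (L \<union> layer W) \<union> L'"
  have "connected_set D"
    unfolding D_def using L L' connected_layer[OF assms(2,3)] by (intro connected_set_Un) auto
  moreover have DW: "D \<subseteq> W" using L L' lW by (auto simp: D_def)
  moreover have "inner_boundary W \<subseteq> D" using inner_boundary_subset_layer by (auto simp: D_def)
  \<comment> \<open>With \<open>n\<close> boundary edges, the layer has at most \<open>9 * n\<close>
    vertices and each segment at most \<open>n / 2\<close>. This makes at most \<open>10 * n\<close>
    vertices and \<open>20 * n\<close> edges, so 22 leaves room.\<close>
  moreover have "card (induced D) \<le> 22 * card (edge_boundary W)"
  proof -
    have "finite D" using DW assms(1) finite_subset by blast
    moreover have "card D \<le> card L + card (layer W) + card L'"
      unfolding D_def by (meson add_mono card_Un_le order_refl order_trans)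
    moreover have "2 * card (fst ` W) \<le> card (edge_boundary W)"
      using card_vboundary_ge[OF assms(1)] card_boundary[OF assms(1)] by linarith
    ultimately show ?thesis
      using card_induced(1)[of D] card_layer[OF assms(1)] L(5) L'(5) by linarith
  qed
  moreover have "u \<in> D" "v \<in> D" using L(3) L'(3) by (simp_all add: D_def)
  ultimately show thesis using that by blast
qed

section \<open>Filling the holes of a finite cluster\<close>

lemma fill_exists:
  assumes V: "finite V" "connected_set V" and v0: "v0 \<in> V"
  obtains W where "V \<subseteq> W" "finite W" "connected_set W" "connected_set (- W)"
    "edge_boundary W \<subseteq> edge_boundary V"
proof -
  obtain M where M: "V \<subseteq> {- M..M} \<times> {- M..M}"
  proof -
    have "finite ((\<lambda>v. max \<bar>fst v\<bar> \<bar>snd v\<bar>) ` V)" using V by simp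
    then obtain M where M: "\<forall>v\<in>V. max \<bar>fst v\<bar> \<bar>snd v\<bar> \<le> M"
      by (meson bdd_above_finite bdd_above_def imageI)
    have "V \<subseteq> {- M..M} \<times> {- M..M}"
    proof
      fix v assume "v \<in> V"
      with M have "\<bar>fst v\<bar> \<le> M" "\<bar>snd v\<bar> \<le> M" by auto
      then show "v \<in> {- M..M} \<times> {- M..M}" by (cases v) auto
    qed
    then show thesis by (rule that)
  qed
  let ?box = "{- M..M} \<times> {- M..M}"
  define z where "z = (M + 1, M + 1)"
  define R where "R = {(a, b). {a, b} \<in> induced (- V)}"
  \<comment> \<open>\<open>U\<close> is the unbounded component of the complement of
    \<open>V\<close>, reached from a corner just outside a box around \<open>V\<close>. The filling
    is its complement.\<close>
  define U where "U = {u. (z, u) \<in> R\<^sup>*}"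
  have zb: "z \<in> - ?box" by (simp add: z_def)
  have UV: "u \<notin> V" if "u \<in> U" for u
  proof -
    have "(z, u) \<in> R\<^sup>*" using that by (simp add: U_def)
    then show ?thesis by (cases rule: rtranclE) (use zb M in \<open>auto simp: R_def\<close>)
  qed
  have ext: "b \<in> U" if "a \<in> U" "adj a b" "b \<notin> V" for a b
    using that UV[of a] unfolding U_def R_def
    by (auto intro!: rtrancl_into_rtrancl[of z a])
  have box: "- ?box \<subseteq> U"
  proof
    fix u assume "u \<in> - ?box"
    then have "(z, u) \<in> {(a, b). {a, b} \<in> induced (- ?box)}\<^sup>*"
      using connected_Compl_rectangle zb unfolding connected_graph_def by blast
    moreover have "{(a, b). {a, b} \<in> induced (- ?box)} \<subseteq> R" using M by (auto simp: R_def)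
    ultimately show "u \<in> U" unfolding U_def using rtrancl_mono by blast
  qed
  have cU: "connected_set U"
  proof (rule connected_setI)
    fix f u v assume f: "locally_constant U f" and uv: "u \<in> U" "v \<in> U"
    have "f z = f w" if "(z, w) \<in> R\<^sup>*" for w
      using that
    proof (induction rule: rtrancl_induct)
      case (step a b)
      have "a \<in> U" "b \<in> U" using step.hyps by (auto simp: U_def intro: rtrancl_into_rtrancl)
      moreover have "adj a b" using step.hyps(2) by (simp add: R_def)
      ultimately show ?case using f step.IH by (auto simp: locally_constant_def)
    qed simp
    with uv show "f u = f v" unfolding U_def by (metis mem_Collect_eq)
  qed
  have cW: "connected_set (- U)"
  proof (rule connected_setI)
    fix f u v assume f: "locally_constant (- U) f" and uv: "u \<in> - U" "v \<in> - U"
    have fV: "f w = f v0" if "w \<in> V" for w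
      using that v0 UV by (intro connected_set_constant[OF V(2) locally_constant_subset[OF f]]) auto
    have iso: "b \<notin> U \<and> f b \<noteq> f v0" if "a \<notin> U" "f a \<noteq> f v0" "adj a b" for a b
    proof -
      have "a \<notin> V" using that(2) fV by blast
      then have "b \<notin> U" using ext[of b a] that adj_commute by blast
      moreover from this have "f a = f b" using that f unfolding locally_constant_def by blast
      ultimately show ?thesis using that(2) by simp
    qed
    \<comment> \<open>A part of \<open>- U\<close> where \<open>f\<close> differs from its value on
      \<open>V\<close> would have no neighbour outside itself: a step into \<open>U\<close> would
      have to start in \<open>V\<close>. Connectedness of the whole lattice rules this out.\<close>
    have "locally_constant UNIV (\<lambda>w. w \<notin> U \<and> f w \<noteq> f v0)"
      unfolding locally_constant_def using iso adj_commute by blast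
    then have "(w \<notin> U \<and> f w \<noteq> f v0) = (v0 \<notin> U \<and> f v0 \<noteq> f v0)" for w
      by (rule connected_set_constant[OF connected_UNIV]) auto
    with uv show "f u = f v" by (metis ComplD)
  qed
  show thesis
  proof (rule that[of "- U"])
    show "V \<subseteq> - U" using UV by auto
    show "finite (- U)" using box by (rule_tac finite_subset[of _ ?box]) auto
    show "edge_boundary (- U) \<subseteq> edge_boundary V"
    proof
      fix e assume "e \<in> edge_boundary (- U)"
      then obtain a b where e: "e = {a, b}" "adj a b" "a \<in> - U" "b \<notin> - U" by (rule boundaryE)
      then have "a \<in> V" using ext[of b a] by (auto simp: adj_commute)
      with e UV show "e \<in> edge_boundary V" by auto
    qed
  qed (use cU cW in auto)
qed

section \<open>Cylinder events\<close>

definition edge_prob :: "real \<times> real \<Rightarrow> edge \<Rightarrow> real" where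
  "edge_prob p e = (if horizontal e then fst p else snd p)"

definition cylinder :: "real \<times> real \<Rightarrow> edge set \<Rightarrow> edge set \<Rightarrow> (edge \<Rightarrow> bool) set" where
  "cylinder p A B = {\<omega> \<in> space (percolation p). (\<forall>e\<in>A. \<omega> e) \<and> (\<forall>e\<in>B. \<not> \<omega> e)}"

text \<open>For finite \<open>W\<close> and densities in the unit interval, this is the probability
  that all boundary edges of \<open>W\<close> are closed.\<close>

definition closed_weight :: "real \<times> real \<Rightarrow> vertex set \<Rightarrow> real" where
  "closed_weight p W = (1 - fst p) ^ card (hboundary W) * (1 - snd p) ^ card (vboundary W)"

lemma product_prob_space_percolation:
  "product_prob_space (\<lambda>e. measure_pmf (bernoulli_pmf (if horizontal e then fst p else snd p)))"
  by (intro product_prob_spaceI prob_space_measure_pmf)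

lemma prob_space_percolation: "prob_space (percolation p)"
  unfolding percolation_def by (intro prob_space_PiM prob_space_measure_pmf)

lemma sets_cylinder:
  assumes "finite A" "A \<subseteq> edges" "finite B" "B \<subseteq> edges"
  shows "cylinder p A B \<in> sets (percolation p)"
proof -
  have single: "{\<omega> \<in> space (percolation p). P (\<omega> e)} \<in> sets (percolation p)" if "e \<in> edges" for e P
    unfolding percolation_def using that by (intro sets_Collect_single') auto
  show ?thesis
    unfolding cylinder_def using assms
    by (intro sets.sets_Collect_conj sets.sets_Collect_finite_All single) auto
qed

lemma measure_cylinder:
  assumes AB: "finite A" "A \<subseteq> edges" "finite B" "B \<subseteq> edges" "A \<inter> B = {}"
    and p: "0 \<le> fst p" "fst p \<le> 1" "0 \<le> snd p" "snd p \<le> 1"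
  shows "measure (percolation p) (cylinder p A B) = (\<Prod>e\<in>A. edge_prob p e) * (\<Prod>e\<in>B. 1 - edge_prob p e)"
proof -
  let ?M = "\<lambda>e. measure_pmf (bernoulli_pmf (edge_prob p e))"
  interpret product_prob_space ?M edges
    unfolding edge_prob_def by (rule product_prob_space_percolation)
  have perc: "percolation p = PiM edges ?M"
    by (simp add: percolation_def edge_prob_def)
  \<comment> \<open>As a set of truth values this is \<open>{True}\<close> on \<open>A\<close> and,
    by disjointness, \<open>{False}\<close> on \<open>B\<close>.\<close>
  let ?X = "\<lambda>e. {e \<in> A}"
  have "cylinder p A B = {\<omega> \<in> space (PiM edges ?M). \<forall>e\<in>A \<union> B. \<omega> e \<in> ?X e}"
    using AB(5) by (auto simp: cylinder_def perc)
  also have "\<dots> = prod_emb edges ?M (A \<union> B) (Pi\<^sub>E (A \<union> B) ?X)"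
    unfolding prod_emb_def using AB(2,4) by (auto simp: space_PiM Pi_iff)
  finally have "measure (percolation p) (cylinder p A B) = (\<Prod>e\<in>A \<union> B. measure (?M e) (?X e))"
    using AB by (simp add: perc measure_PiM_emb)
  also have "\<dots> = (\<Prod>e\<in>A. measure (?M e) (?X e)) * (\<Prod>e\<in>B. measure (?M e) (?X e))"
    using AB by (intro prod.union_disjoint) auto
  also have "(\<Prod>e\<in>A. measure (?M e) (?X e)) = (\<Prod>e\<in>A. edge_prob p e)"
    using p by (intro prod.cong) (auto simp: measure_pmf_single edge_prob_def)
  also have "(\<Prod>e\<in>B. measure (?M e) (?X e)) = (\<Prod>e\<in>B. 1 - edge_prob p e)"
  proof (intro prod.cong refl)
    fix e assume "e \<in> B"
    then have "e \<notin> A" using AB(5) by auto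
    then show "measure (?M e) (?X e) = 1 - edge_prob p e"
      using p by (simp add: measure_pmf_single edge_prob_def)
  qed
  finally show ?thesis .
qed

lemma edge_boundary_subset: "edge_boundary W \<subseteq> edges"
  by (auto simp: edge_boundary_def)

lemma prod_edge_boundary:
  assumes "finite W"
  shows "(\<Prod>e\<in>edge_boundary W. 1 - edge_prob p e) = closed_weight p W"
proof -
  have "(\<Prod>e\<in>edge_boundary W. 1 - edge_prob p e)
      = (\<Prod>e\<in>edge_boundary W. if horizontal e then 1 - fst p else 1 - snd p)"
    by (intro prod.cong) (auto simp: edge_prob_def)
  also have "\<dots> = closed_weight p W"
    using prod.If_cases[OF finite_boundary[OF assms], of horizontal "\<lambda>_. 1 - fst p" "\<lambda>_. 1 - snd p"]
    by (simp add: closed_weight_def Collect_conj_eq[symmetric] Int_def)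
  finally show ?thesis .
qed

section \<open>Regions and the truncated connectivity\<close>

text \<open>The possible fillings of finite clusters of the origin: connected sets without
  holes.\<close>

definition region :: "vertex set \<Rightarrow> bool" where
  "region W \<longleftrightarrow> finite W \<and> (0, 0) \<in> W \<and> connected_set W \<and> connected_set (- W)"

definition truncated_event :: "real \<times> real \<Rightarrow> vertex \<Rightarrow> (edge \<Rightarrow> bool) set" where
  "truncated_event p x =
     {\<omega> \<in> space (percolation p). \<exists>V E. open_cluster \<omega> V E \<and> {(0, 0), x} \<subseteq> V \<and> finite E}"

text \<open>Every vertex other than \<open>x\<close> is the last vertex of a path from
  \<open>x\<close>, hence an endpoint of an edge in \<open>E\<close>.\<close>

lemma open_cluster_finite:
  assumes "open_cluster \<omega> V E" "x \<in> V" "finite E"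
  shows "finite V"
proof -
  have E: "E \<subseteq> edges" "connected_graph V E"
    using assms(1) by (auto simp: open_cluster_def subgraph_def)
  have "V \<subseteq> insert x (\<Union>E)"
  proof
    fix v assume "v \<in> V"
    then have "(x, v) \<in> {(a, b). {a, b} \<in> E}\<^sup>*"
      using E(2) assms(2) unfolding connected_graph_def by blast
    then show "v \<in> insert x (\<Union>E)" by (cases rule: rtranclE) auto
  qed
  moreover have "finite (\<Union>E)" using E(1) assms(3) by (auto elim: edgeE)
  ultimately show ?thesis by (meson finite_insert finite_subset)
qed

lemma open_cluster_connected_set:
  assumes "open_cluster \<omega> V E"
  shows "connected_set V"
proof -
  have "E \<subseteq> induced V" "connected_graph V E"
    using assms by (auto simp: open_cluster_def subgraph_def induced_def)
  moreover from this have "{(a, b). {a, b} \<in> E}\<^sup>* \<subseteq> {(a, b). {a, b} \<in> induced V}\<^sup>*"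
    by (intro rtrancl_mono) blast
  ultimately show ?thesis unfolding connected_graph_def by blast
qed

text \<open>There are only countably many finite pairs \<open>(V, E)\<close>, and each of them
  contributes a cylinder event.\<close>

lemma sets_truncated_event: "truncated_event p x \<in> sets (percolation p)"
proof -
  define S where "S = {(V, E). finite V \<and> finite E \<and> subgraph V E \<and> connected_graph V E \<and> {(0, 0), x} \<subseteq> V}"
  have "truncated_event p x = (\<Union>(V, E)\<in>S. cylinder p E (edge_boundary V))"
  proof (intro equalityI subsetI)
    fix \<omega> assume "\<omega> \<in> truncated_event p x"
    then obtain V E where *: "\<omega> \<in> space (percolation p)" "open_cluster \<omega> V E" "{(0, 0), x} \<subseteq> V" "finite E"
      unfolding truncated_event_def by blast
    moreover have "finite V" using * by (intro open_cluster_finite[of \<omega> V E "(0, 0)"]) auto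
    ultimately have "(V, E) \<in> S" "\<omega> \<in> cylinder p E (edge_boundary V)"
      by (auto simp: S_def cylinder_def open_cluster_def)
    then show "\<omega> \<in> (\<Union>(V, E)\<in>S. cylinder p E (edge_boundary V))" by blast
  next
    fix \<omega> assume "\<omega> \<in> (\<Union>(V, E)\<in>S. cylinder p E (edge_boundary V))"
    then obtain V E where "(V, E) \<in> S" "\<omega> \<in> cylinder p E (edge_boundary V)" by blast
    then have "\<omega> \<in> space (percolation p)" "open_cluster \<omega> V E \<and> {(0, 0), x} \<subseteq> V \<and> finite E"
      by (simp_all add: S_def cylinder_def open_cluster_def)
    then show "\<omega> \<in> truncated_event p x" unfolding truncated_event_def by blast
  qed
  moreover have "countable S"
  proof (rule countable_subset)
    show "S \<subseteq> Collect finite \<times> {E. finite E \<and> E \<subseteq> edges}" by (auto simp: S_def subgraph_def)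
    show "countable (Collect finite \<times> {E. finite E \<and> E \<subseteq> edges} :: (vertex set \<times> edge set) set)"
      by (intro countable_SIGMA countable_Collect_finite countable_Collect_finite_subset countable_edges)
  qed
  moreover have "cylinder p E (edge_boundary V) \<in> sets (percolation p)" if "(V, E) \<in> S" for V E
    using that by (intro sets_cylinder edge_boundary_subset) (auto simp: S_def subgraph_def finite_boundary)
  ultimately show ?thesis by (auto intro!: sets.countable_UN')
qed

text \<open>Filling the holes of the cluster creates no new boundary edges, so the boundary of the
  filling is closed too.\<close>

lemma truncated_event_subset_regions:
  "truncated_event p x \<subseteq> (\<Union>W\<in>{W. region W \<and> x \<in> W}. cylinder p {} (edge_boundary W))"
proof
  fix \<omega> assume "\<omega> \<in> truncated_event p x"
  then obtain V E where *: "\<omega> \<in> space (percolation p)" "open_cluster \<omega> V E" "{(0, 0), x} \<subseteq> V" "finite E"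
    unfolding truncated_event_def by blast
  then have o: "(0, 0) \<in> V" "x \<in> V" by auto
  obtain W where W: "V \<subseteq> W" "finite W" "connected_set W" "connected_set (- W)"
    "edge_boundary W \<subseteq> edge_boundary V"
    using fill_exists[OF open_cluster_finite[OF *(2) o(1) *(4)] open_cluster_connected_set[OF *(2)] o(1)]
    by blast
  have "\<omega> \<in> cylinder p {} (edge_boundary W)"
    using *(1,2) W(5) by (auto simp: cylinder_def open_cluster_def)
  moreover have "region W" "x \<in> W" using W o by (auto simp: region_def)
  ultimately show "\<omega> \<in> (\<Union>W\<in>{W. region W \<and> x \<in> W}. cylinder p {} (edge_boundary W))" by blast
qed

text \<open>The union bound over regions. Stating \<open>bound\<close> for finite partial sums
  avoids any question of summability.\<close>

lemma truncated_connectivity_le: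
  assumes p: "0 \<le> fst p" "fst p \<le> 1" "0 \<le> snd p" "snd p \<le> 1"
    and bound: "\<And>F. finite F \<Longrightarrow> F \<subseteq> {W. region W \<and> x \<in> W} \<Longrightarrow> (\<Sum>W\<in>F. closed_weight p W) \<le> c"
  shows "truncated_connectivity p (0, 0) x \<le> c"
proof -
  interpret prob_space "percolation p" by (rule prob_space_percolation)
  let ?S = "{W. region W \<and> x \<in> W}" and ?A = "\<lambda>W. cylinder p {} (edge_boundary W)"
  have fin: "finite W" if "W \<in> ?S" for W using that by (simp add: region_def)
  have meas: "?A W \<in> sets (percolation p)" if "W \<in> ?S" for W
    using fin[OF that] by (intro sets_cylinder edge_boundary_subset finite_boundary) auto
  have "countable ?S"
    by (rule countable_subset[OF _ countable_Collect_finite]) (auto simp: region_def)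
  then have "measure (percolation p) (\<Union>W\<in>?S. ?A W) \<le> c"
  proof (rule measure_UN_bound)
    show "?A W \<in> fmeasurable (percolation p)" if "W \<in> ?S" for W
      using meas[OF that] by (simp add: fmeasurable_eq_sets)
    fix F assume F: "F \<subseteq> ?S" "finite F"
    have "measure (percolation p) (\<Union>W\<in>F. ?A W) \<le> (\<Sum>W\<in>F. measure (percolation p) (?A W))"
      using F meas by (intro measure_UNION_le) auto
    also have "\<dots> = (\<Sum>W\<in>F. closed_weight p W)"
    proof (intro sum.cong refl)
      fix W assume "W \<in> F"
      then have W: "finite W" using F fin by blast
      then have "measure (percolation p) (?A W) = (\<Prod>e\<in>edge_boundary W. 1 - edge_prob p e)"
        by (subst measure_cylinder) (simp_all add: p finite_boundary edge_boundary_subset)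
      with W show "measure (percolation p) (?A W) = closed_weight p W"
        by (simp add: prod_edge_boundary)
    qed
    also have "\<dots> \<le> c" by (intro bound F)
    finally show "measure (percolation p) (\<Union>W\<in>F. ?A W) \<le> c" .
  qed
  moreover have "measure (percolation p) (truncated_event p x) \<le> measure (percolation p) (\<Union>W\<in>?S. ?A W)"
    using meas \<open>countable ?S\<close>
    by (intro finite_measure_mono truncated_event_subset_regions sets.countable_UN') auto
  ultimately show ?thesis
    by (simp add: truncated_connectivity_def truncated_event_def)
qed

section \<open>The cluster of the origin and the lower bound\<close>

definition origin_cluster :: "(edge \<Rightarrow> bool) \<Rightarrow> vertex set" where
  "origin_cluster \<omega> = {v. ((0, 0), v) \<in> {(a, b). adj a b \<and> \<omega> {a, b}}\<^sup>*}"

lemma origin_cluster_step: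
  "a \<in> origin_cluster \<omega> \<Longrightarrow> adj a b \<Longrightarrow> \<omega> {a, b} \<Longrightarrow> b \<in> origin_cluster \<omega>"
  by (auto simp: origin_cluster_def intro: rtrancl_into_rtrancl)

lemma origin_cluster_subset:
  assumes "(0, 0) \<in> W" "\<forall>e\<in>edge_boundary W. \<not> \<omega> e"
  shows "origin_cluster \<omega> \<subseteq> W"
proof
  fix v assume "v \<in> origin_cluster \<omega>"
  then have "((0, 0), v) \<in> {(a, b). adj a b \<and> \<omega> {a, b}}\<^sup>*" by (simp add: origin_cluster_def)
  then show "v \<in> W"
  proof (induction rule: rtrancl_induct)
    case (step a b)
    then show ?case using assms(2) boundary_iff[of a b W] by blast
  qed (rule assms(1))
qed

lemma subset_origin_cluster:
  assumes "(0, 0) \<in> D" "connected_set D" "\<forall>e\<in>induced D. \<omega> e"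
  shows "D \<subseteq> origin_cluster \<omega>"
proof
  fix v assume "v \<in> D"
  then have "((0, 0), v) \<in> {(a, b). {a, b} \<in> induced D}\<^sup>*"
    using assms unfolding connected_graph_def by blast
  moreover have "{(a, b). {a, b} \<in> induced D} \<subseteq> {(a, b). adj a b \<and> \<omega> {a, b}}"
    using assms(3) by auto
  ultimately show "v \<in> origin_cluster \<omega>"
    unfolding origin_cluster_def using rtrancl_mono by blast
qed

lemma open_cluster_origin_cluster:
  "open_cluster \<omega> (origin_cluster \<omega>) {e \<in> induced (origin_cluster \<omega>). \<omega> e}"
proof -
  let ?C = "origin_cluster \<omega>" and ?E = "{e \<in> induced (origin_cluster \<omega>). \<omega> e}"
  let ?R = "{(a, b). {a, b} \<in> ?E}"
  have reach: "((0, 0), v) \<in> ?R\<^sup>*" if "v \<in> ?C" for v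
  proof -
    have "((0, 0), v) \<in> {(a, b). adj a b \<and> \<omega> {a, b}}\<^sup>*" using that by (simp add: origin_cluster_def)
    then show ?thesis
    proof (induction rule: rtrancl_induct)
      case (step a b)
      have "a \<in> ?C" using step.hyps(1) by (simp add: origin_cluster_def)
      moreover from this have "b \<in> ?C" using step.hyps(2) by (auto intro: origin_cluster_step)
      ultimately have "(a, b) \<in> ?R" using step.hyps(2) by simp
      with step.IH show ?case by (rule rtrancl_into_rtrancl)
    qed simp
  qed
  have "sym ?R" by (auto simp: sym_def insert_commute adj_commute)
  then have "sym (?R\<^sup>*)" by (rule sym_rtrancl)
  then have "(u, v) \<in> ?R\<^sup>*" if "u \<in> ?C" "v \<in> ?C" for u v
    using reach[OF that(1)] reach[OF that(2)] by (meson rtrancl_trans symD)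
  then have "connected_graph ?C ?E" by (auto simp: connected_graph_def)
  moreover have "\<not> \<omega> e" if "e \<in> edge_boundary ?C" for e
    using that by (auto elim!: boundaryE dest: origin_cluster_step)
  moreover have "subgraph ?C ?E" by (auto simp: subgraph_def induced_def)
  ultimately show ?thesis by (auto simp: open_cluster_def)
qed

text \<open>A path outside \<open>W\<close> cannot leave \<open>W'\<close>, because it would pass
  through the inner boundary of \<open>W'\<close>. So a vertex of \<open>W'\<close> outside
  \<open>W\<close> would force all of \<open>- W\<close> into \<open>W'\<close>, and the lattice
  would be finite.\<close>

lemma region_subset_of_inner_boundary:
  assumes "finite W'" "finite W" "connected_set (- W)" "inner_boundary W' \<subseteq> W"
  shows "W' \<subseteq> W"
proof
  fix u assume u: "u \<in> W'"
  show "u \<in> W"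
  proof (rule ccontr)
    assume uW: "u \<notin> W"
    have "locally_constant (- W) (\<lambda>v. v \<in> W')"
      unfolding locally_constant_def
    proof (intro ballI impI)
      fix a b assume "a \<in> - W" "b \<in> - W" "adj a b"
      then show "(a \<in> W') = (b \<in> W')"
        using assms(4) adj_commute[of a b] unfolding inner_boundary_def by blast
    qed
    from connected_set_constant[OF assms(3) this, of u] u uW have "- W \<subseteq> W'" by blast
    then have "UNIV = W \<union> W'" by blast
    then have "finite (UNIV :: vertex set)" using assms(1,2) by (metis finite_UnI)
    then show False by (simp add: finite_prod)
  qed
qed

text \<open>The factor \<open>m ^ (22 * \<dots>)\<close> is the price for opening a skeleton, which forces the cluster of the
  origin to have the region \<open>W\<close> as its filling.\<close>

lemma sum_le_truncated_connectivity:
  assumes p: "0 \<le> m" "m \<le> fst p" "fst p \<le> 1" "m \<le> snd p" "snd p \<le> 1"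
    and F: "finite F" "F \<subseteq> {W. region W \<and> x \<in> W}"
  shows "(\<Sum>W\<in>F. closed_weight p W * m ^ (22 * card (edge_boundary W))) \<le> truncated_connectivity p (0, 0) x"
proof -
  interpret prob_space "percolation p" by (rule prob_space_percolation)
  have reg: "finite W" "(0, 0) \<in> W" "connected_set W" "connected_set (- W)" "x \<in> W" if "W \<in> F" for W
    using F(2) that by (auto simp: region_def)
  have "\<forall>W\<in>F. \<exists>D. D \<subseteq> W \<and> connected_set D \<and> (0, 0) \<in> D \<and> x \<in> D \<and> inner_boundary W \<subseteq> D
      \<and> card (induced D) \<le> 22 * card (edge_boundary W)"
  proof
    fix W assume "W \<in> F"
    note W = reg[OF this]
    show "\<exists>D. D \<subseteq> W \<and> connected_set D \<and> (0, 0) \<in> D \<and> x \<in> D \<and> inner_boundary W \<subseteq> D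
      \<and> card (induced D) \<le> 22 * card (edge_boundary W)"
      by (rule skeleton_exists[OF W(1,3,4,2,5)]) blast
  qed
  from bchoice[OF this] obtain D where "\<forall>W\<in>F. D W \<subseteq> W \<and> connected_set (D W) \<and> (0, 0) \<in> D W \<and> x \<in> D W
      \<and> inner_boundary W \<subseteq> D W \<and> card (induced (D W)) \<le> 22 * card (edge_boundary W)"
    by (rule exE)
  then have D: "D W \<subseteq> W" "connected_set (D W)" "(0, 0) \<in> D W" "x \<in> D W" "inner_boundary W \<subseteq> D W"
    "card (induced (D W)) \<le> 22 * card (edge_boundary W)" if "W \<in> F" for W
    using that by simp_all
  define G where "G W = cylinder p (induced (D W)) (edge_boundary W)" for W
  have finD: "finite (D W)" if "W \<in> F" for W using D(1)[OF that] reg(1)[OF that] by (rule finite_subset)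
  have meas: "G W \<in> sets (percolation p)" if "W \<in> F" for W
    unfolding G_def using finD[OF that] reg(1)[OF that]
    by (intro sets_cylinder card_induced(2) finite_boundary edge_boundary_subset) (auto simp: induced_def)
  have cluster: "D W \<subseteq> origin_cluster \<omega>" "origin_cluster \<omega> \<subseteq> W" if "W \<in> F" "\<omega> \<in> G W" for W \<omega>
  proof -
    have "\<forall>e\<in>induced (D W). \<omega> e" "\<forall>e\<in>edge_boundary W. \<not> \<omega> e"
      using that(2) by (auto simp: G_def cylinder_def)
    then show "D W \<subseteq> origin_cluster \<omega>" "origin_cluster \<omega> \<subseteq> W"
      using subset_origin_cluster[OF D(3,2)[OF that(1)]] origin_cluster_subset[OF reg(2)[OF that(1)]]
      by simp_all
  qed
  \<comment> \<open>If both events occur, the inner boundary of \<open>W'\<close> lies in the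
    skeleton of \<open>W'\<close>, hence in the cluster of the origin, hence in \<open>W\<close>. By
    symmetry the two regions coincide.\<close>
  have disj: "W' \<subseteq> W" if "W \<in> F" "W' \<in> F" "\<omega> \<in> G W" "\<omega> \<in> G W'" for W W' \<omega>
  proof (rule region_subset_of_inner_boundary)
    show "inner_boundary W' \<subseteq> W"
      using D(5)[OF that(2)] cluster(1)[OF that(2,4)] cluster(2)[OF that(1,3)] by blast
  qed (use reg that in blast)+
  have "disjoint_family_on G F"
    unfolding disjoint_family_on_def using disj by blast
  then have "(\<Sum>W\<in>F. measure (percolation p) (G W)) = measure (percolation p) (\<Union>W\<in>F. G W)"
    using F(1) meas by (intro finite_measure_finite_Union[symmetric]) auto
  also have "\<dots> \<le> measure (percolation p) (truncated_event p x)"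
  proof (intro finite_measure_mono sets_truncated_event UN_least subsetI)
    fix W \<omega> assume W: "W \<in> F" "\<omega> \<in> G W"
    note c = cluster[OF W]
    have "finite (origin_cluster \<omega>)" using c(2) reg(1)[OF W(1)] by (rule finite_subset)
    then have "finite {e \<in> induced (origin_cluster \<omega>). \<omega> e}" by (simp add: card_induced(2))
    moreover have "{(0, 0), x} \<subseteq> origin_cluster \<omega>" using c(1) D(3,4)[OF W(1)] by auto
    moreover have "\<omega> \<in> space (percolation p)" using W(2) by (simp add: G_def cylinder_def)
    ultimately show "\<omega> \<in> truncated_event p x"
      unfolding truncated_event_def using open_cluster_origin_cluster by blast
  qed
  finally have "(\<Sum>W\<in>F. measure (percolation p) (G W)) \<le> truncated_connectivity p (0, 0) x"
    by (simp add: truncated_connectivity_def truncated_event_def)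
  \<comment> \<open>Skeleton and boundary are disjoint, so the probability is a product, and each of
    the at most \<open>22 * card (edge_boundary W)\<close> skeleton edges contributes at least
    \<open>m\<close>.\<close>
  moreover have "closed_weight p W * m ^ (22 * card (edge_boundary W)) \<le> measure (percolation p) (G W)"
    if "W \<in> F" for W
  proof -
    have W: "finite W" "D W \<subseteq> W" using reg(1) D(1) that by auto
    have "induced (D W) \<inter> edge_boundary W = {}"
      using W(2) by (auto elim!: boundaryE)
    moreover have "induced (D W) \<subseteq> edges" by (auto simp: induced_def)
    ultimately have "measure (percolation p) (G W)
        = (\<Prod>e\<in>induced (D W). edge_prob p e) * closed_weight p W"
      unfolding G_def prod_edge_boundary[OF W(1), symmetric] using p W(1) finD[OF that]
      by (intro measure_cylinder card_induced(2) finite_boundary edge_boundary_subset) auto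
    moreover have "0 \<le> closed_weight p W" using p by (simp add: closed_weight_def)
    moreover have "m ^ (22 * card (edge_boundary W)) \<le> (\<Prod>e\<in>induced (D W). edge_prob p e)"
    proof -
      have "m ^ (22 * card (edge_boundary W)) \<le> m ^ card (induced (D W))"
        using D(6)[OF that] p by (intro power_decreasing) auto
      also have "\<dots> = (\<Prod>e\<in>induced (D W). m)" by simp
      also have "\<dots> \<le> (\<Prod>e\<in>induced (D W). edge_prob p e)"
        using p by (intro prod_mono) (auto simp: edge_prob_def)
      finally show ?thesis .
    qed
    ultimately show ?thesis by (metis mult.commute mult_right_mono)
  qed
  ultimately show ?thesis by (meson order_trans sum_mono)
qed

lemma truncated_connectivity_le_1: "truncated_connectivity p x y \<le> 1"
proof -
  interpret prob_space "percolation p" by (rule prob_space_percolation)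
  show ?thesis unfolding truncated_connectivity_def by (rule prob_le_1)
qed

text \<open>The entropy bound comes for free from percolation at \<open>p = (1/2, 1/2)\<close>: there the events in the
  previous lemma are disjoint and each has probability at least \<open>2\<^sup>-\<^sup>2\<^sup>3\<^sup>n\<close>.\<close>

lemma sum_regions_le_1:
  assumes "finite F" "\<And>W. W \<in> F \<Longrightarrow> region W"
  shows "(\<Sum>W\<in>F. (1 / 2) ^ (23 * card (edge_boundary W))) \<le> (1 :: real)"
proof -
  \<comment> \<open>Per boundary edge, one factor 1/2 closes it and 22 factors pay for the
    skeleton.\<close>
  have "(1 / 2) ^ (23 * card (edge_boundary W))
      = closed_weight (1/2, 1/2) W * (1/2) ^ (22 * card (edge_boundary W))" if "W \<in> F" for W
  proof -
    have "closed_weight (1/2, 1/2) W = (1/2) ^ card (edge_boundary W)"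
      using assms(2)[OF that] by (simp add: closed_weight_def region_def card_boundary power_add)
    moreover have "23 * card (edge_boundary W) = card (edge_boundary W) + 22 * card (edge_boundary W)"
      by simp
    ultimately show ?thesis by (simp only: power_add)
  qed
  then have "(\<Sum>W\<in>F. (1 / 2) ^ (23 * card (edge_boundary W)))
      = (\<Sum>W\<in>F. closed_weight (1/2, 1/2) W * (1/2) ^ (22 * card (edge_boundary W)))"
    by (rule sum.cong[OF refl])
  also have "\<dots> \<le> truncated_connectivity (1/2, 1/2) (0, 0) (0, 0)"
    using assms by (intro sum_le_truncated_connectivity) (auto simp: region_def)
  also have "\<dots> \<le> 1" by (rule truncated_connectivity_le_1)
  finally show ?thesis .
qed

section \<open>Comparison with the reflected regions\<close>

lemma region_swap:
  assumes "region W"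
  shows "region (prod.swap ` W)"
proof -
  have "- (prod.swap ` W) = prod.swap ` (- W)" by (simp add: bij_image_Compl_eq)
  then show ?thesis
    using assms by (force simp: region_def intro: connected_set_swap)
qed

text \<open>The projections of a connected set are intervals, here containing \<open>{0..x1}\<close>
  and \<open>{0..x2}\<close>, and every occupied row or column costs two boundary edges.\<close>

lemma region_card_boundary_ge:
  assumes "region W" "(x1, x2) \<in> W" "0 \<le> x1" "0 \<le> x2"
  shows "2 * nat (x2 + 1) \<le> card (hboundary W)" "2 * nat (x1 + 1) \<le> card (vboundary W)"
proof -
  have W: "finite W" "(0, 0) \<in> W" "connected_set W" using assms(1) by (auto simp: region_def)
  have "card {0..x2} \<le> card (snd ` W)" "card {0..x1} \<le> card (fst ` W)"
    using connected_set_snd_convex[OF W(3,2) assms(2)] connected_set_fst_convex[OF W(3,2) assms(2)]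
    by (intro card_mono finite_imageI W(1); simp)+
  then show "2 * nat (x2 + 1) \<le> card (hboundary W)" "2 * nat (x1 + 1) \<le> card (vboundary W)"
    using card_hboundary_ge[OF W(1)] card_vboundary_ge[OF W(1)] by simp_all
qed

lemma region_rectangle:
  assumes "0 \<le> a" "0 \<le> b"
  shows "region ({0..a} \<times> {0..b})"
  using assms connected_rectangle connected_Compl_rectangle by (auto simp: region_def)

text \<open>A region whose boundary is at most \<open>\<Delta>\<close> longer than the shortest possible one has at least
  \<open>\<Delta>\<close> more horizontal than vertical boundary edges.\<close>

lemma closed_weight_short_boundary:
  fixes p_h p_v \<kappa> s :: real and K \<Delta> :: nat
  assumes W: "region W" "(x1, x2) \<in> W" "0 < x1" "x1 < x2"
    and \<Delta>: "\<Delta> = nat (x2 - x1)" "nat (2 * (x1 + x2 + 2)) \<le> K * \<Delta>"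
    and short: "card (edge_boundary W) \<le> nat (2 * (x1 + x2 + 2)) + \<Delta>"
    and p: "0 < p_h" "p_h \<le> 1" "p_v \<le> 1" "1 - p_v \<le> \<kappa> * (1 - p_h)"
    and \<kappa>: "0 \<le> \<kappa>" "\<kappa> \<le> 1" "\<kappa> \<le> s * p_h ^ (22 * (K + 1))" and s: "0 \<le> s" "s \<le> 1"
  shows "closed_weight (p_h, p_v) (prod.swap ` W)
    \<le> s * (closed_weight (p_h, p_v) W * p_h ^ (22 * card (edge_boundary W)))"
proof -
  have fin: "finite W" using W(1) by (simp add: region_def)
  define h v where "h = card (hboundary W)" and "v = card (vboundary W)"
  have n: "card (edge_boundary W) = h + v" using card_boundary[OF fin] by (simp add: h_def v_def)
  have "2 * nat (x2 + 1) \<le> h"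
    using region_card_boundary_ge(1)[OF W(1,2)] W(3,4) by (simp add: h_def)
  then have "2 * (x2 + 1) \<le> int h" using W(3,4) by simp
  moreover have "int h + int v \<le> 2 * (x1 + x2 + 2) + int \<Delta>"
    using short W(3,4) unfolding n by (simp add: nat_le_iff le_nat_iff)
  moreover have "int \<Delta> = x2 - x1" using \<Delta>(1) W(4) by simp
  \<comment> \<open>The bounds fit exactly:
    \<open>2 * (x1 + x2 + 2) + 2 * \<Delta> = 4 * (x2 + 1) \<le> 2 * h\<close>.\<close>
  ultimately have "int v + int \<Delta> \<le> int h" by presburger
  then have hv: "v + \<Delta> \<le> h" by linarith
  define d where "d = h - v"
  have d: "h = v + d" "\<Delta> \<le> d" using hv by (auto simp: d_def)
  have "\<Delta> \<ge> 1" using W(4) \<Delta>(1) by simp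
  \<comment> \<open>Since \<open>\<Delta>\<close> is at least 1, one factor \<open>s\<close> is kept
    as the gain; the powers of \<open>p_h\<close> cover the price of a skeleton.\<close>
  have "\<kappa> ^ d \<le> \<kappa> ^ \<Delta>" using \<kappa> d(2) by (intro power_decreasing) auto
  also have "\<dots> \<le> (s * p_h ^ (22 * (K + 1))) ^ \<Delta>" using \<kappa> by (intro power_mono) auto
  also have "\<dots> = s ^ \<Delta> * p_h ^ (22 * (K + 1) * \<Delta>)" by (simp only: power_mult_distrib power_mult)
  also have "\<dots> \<le> s * p_h ^ (22 * card (edge_boundary W))"
  proof (intro mult_mono)
    show "s ^ \<Delta> \<le> s" using power_decreasing[OF \<open>\<Delta> \<ge> 1\<close> s] by simp
    have "card (edge_boundary W) \<le> (K + 1) * \<Delta>" using short \<Delta>(2) by simp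
    then have "22 * card (edge_boundary W) \<le> 22 * (K + 1) * \<Delta>" by linarith
    then show "p_h ^ (22 * (K + 1) * \<Delta>) \<le> p_h ^ (22 * card (edge_boundary W))"
      using p by (intro power_decreasing) auto
  qed (use s p in auto)
  finally have \<kappa>d: "\<kappa> ^ d \<le> s * p_h ^ (22 * card (edge_boundary W))" .
  \<comment> \<open>Reflection exchanges \<open>h\<close> and \<open>v\<close>: in effect the
    \<open>d\<close> surplus horizontal edges become vertical, each at a relative cost of at most
    \<open>\<kappa>\<close>.\<close>
  have "closed_weight (p_h, p_v) (prod.swap ` W) = (1 - p_h) ^ v * (1 - p_v) ^ v * (1 - p_v) ^ d"
    by (simp add: closed_weight_def card_boundary_swap[OF fin] h_def[symmetric] v_def[symmetric] d(1) power_add)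
  also have "\<dots> \<le> (1 - p_h) ^ v * (1 - p_v) ^ v * (\<kappa> * (1 - p_h)) ^ d"
    using p by (intro mult_left_mono power_mono) auto
  also have "\<dots> = ((1 - p_h) ^ v * (1 - p_v) ^ v * (1 - p_h) ^ d) * \<kappa> ^ d"
    by (simp add: power_mult_distrib)
  also have "\<dots> \<le> ((1 - p_h) ^ v * (1 - p_v) ^ v * (1 - p_h) ^ d) * (s * p_h ^ (22 * card (edge_boundary W)))"
    using p \<kappa>d by (intro mult_left_mono) auto
  also have "(1 - p_h) ^ v * (1 - p_v) ^ v * (1 - p_h) ^ d = closed_weight (p_h, p_v) W"
    by (simp add: closed_weight_def h_def[symmetric] v_def[symmetric] d(1) power_add)
  finally show ?thesis by (simp add: mult_ac)
qed

text \<open>The single term of the rectangle spanned by the origin and \<open>x\<close> suffices.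
  Each of its boundary edges is closed with probability at least \<open>\<eta> * (1 - p_h)\<close>,
  and the skeleton costs at most \<open>2 ^ 22\<close> per boundary edge.\<close>

lemma truncated_connectivity_ge:
  fixes p_h p_v \<eta> :: real
  assumes "0 \<le> x1" "0 \<le> x2" and p: "1 / 2 \<le> p_h" "p_h \<le> p_v" "p_v \<le> 1" "\<eta> * (1 - p_h) \<le> 1 - p_v"
    and \<eta>: "0 \<le> \<eta>" "\<eta> \<le> 1"
  shows "(\<eta> * (1 - p_h) / 2 ^ 22) ^ nat (2 * (x1 + x2 + 2)) \<le> truncated_connectivity (p_h, p_v) (0, 0) (x1, x2)"
proof -
  define R where "R = {0..x1} \<times> {0..x2}"
  have R: "region R" unfolding R_def by (rule region_rectangle) (use assms in auto)
  then have fin: "finite R" by (simp add: region_def)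
  let ?n = "card (edge_boundary R)" and ?c = "\<eta> * (1 - p_h)"
  have n: "?n \<le> nat (2 * (x1 + x2 + 2))"
    using card_boundary_rectangle[of 0 x1 0 x2] assms(1,2) unfolding R_def by (simp add: algebra_simps)
  have c: "0 \<le> ?c" "?c \<le> 1 - p_v" "?c \<le> 1 - p_h" "?c \<le> 1"
    using p \<eta> by (auto intro: mult_left_le_one_le mult_le_one)
  have "(?c / 2 ^ 22) ^ nat (2 * (x1 + x2 + 2)) \<le> (?c / 2 ^ 22) ^ ?n"
    using n c by (intro power_decreasing) auto
  also have "\<dots> = ?c ^ ?n * (1 / 2) ^ (22 * ?n)"
    by (simp only: power_divide power_mult power_one) simp
  also have "\<dots> \<le> closed_weight (p_h, p_v) R * p_h ^ (22 * ?n)"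
  proof (intro mult_mono)
    have "?c ^ card (hboundary R) * ?c ^ card (vboundary R) \<le> closed_weight (p_h, p_v) R"
      unfolding closed_weight_def fst_conv snd_conv using c p by (intro mult_mono power_mono) auto
    then show "?c ^ ?n \<le> closed_weight (p_h, p_v) R"
      by (simp add: card_boundary[OF fin] power_add)
  qed (use p c in \<open>auto intro!: power_mono simp: closed_weight_def\<close>)
  also have "\<dots> = (\<Sum>W\<in>{R}. closed_weight (p_h, p_v) W * p_h ^ (22 * card (edge_boundary W)))" by simp
  also have "\<dots> \<le> truncated_connectivity (p_h, p_v) (0, 0) (x1, x2)"
    using p R assms(1,2) by (intro sum_le_truncated_connectivity) (auto simp: R_def)
  finally show ?thesis .
qed

text \<open>Regions are split at boundary length \<open>N + \<Delta>\<close>: the short ones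
  contribute the fraction \<open>s\<close>, by comparison one by one, and the long ones the fraction
  \<open>\<epsilon>\<close>, by a Peierls bound against the rectangle.\<close>

lemma truncated_connectivity_reflect:
  fixes p_h p_v \<eta> \<kappa> s \<epsilon> :: real and K \<Delta> :: nat
  assumes x: "0 < x1" "x1 < x2" and \<Delta>: "\<Delta> = nat (x2 - x1)" "nat (2 * (x1 + x2 + 2)) \<le> K * \<Delta>"
    and p: "1 / 2 \<le> p_h" "p_h < 1" "p_h \<le> p_v" "p_v \<le> 1" "\<eta> * (1 - p_h) \<le> 1 - p_v" "1 - p_v \<le> \<kappa> * (1 - p_h)"
    and \<eta>: "0 < \<eta>" "\<eta> \<le> 1"
    and \<kappa>: "0 \<le> \<kappa>" "\<kappa> \<le> 1" "\<kappa> \<le> s * p_h ^ (22 * (K + 1))" and s: "0 \<le> s" "s \<le> 1"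
    and \<epsilon>: "(2 ^ 45 / \<eta>) ^ K * (2 ^ 23 * (1 - p_h)) \<le> \<epsilon>" "\<epsilon> \<le> 1"
  shows "truncated_connectivity (p_h, p_v) (0, 0) (x2, x1)
    \<le> (s + \<epsilon>) * truncated_connectivity (p_h, p_v) (0, 0) (x1, x2)"
proof (rule truncated_connectivity_le)
  let ?\<tau> = "truncated_connectivity (p_h, p_v) (0, 0) (x1, x2)" and ?w = "closed_weight (p_h, p_v)"
  let ?n = "\<lambda>W. card (edge_boundary W)"
  define q where "q = 1 - p_h"
  have q: "0 < q" "q \<le> 1" using p by (auto simp: q_def)
  define N where "N = nat (2 * (x1 + x2 + 2))"
  fix F assume F: "finite F" "F \<subseteq> {W. region W \<and> (x2, x1) \<in> W}"
  define F' where "F' = (`) prod.swap ` F"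
  have F': "finite F'" "F' \<subseteq> {W. region W \<and> (x1, x2) \<in> W}"
    using F by (force simp: F'_def region_swap)+
  have regs: "region W" "(x1, x2) \<in> W" "finite W" if "W \<in> F'" for W
    using F'(2) that by (auto simp: region_def)
  let ?S = "{W \<in> F'. ?n W \<le> N + \<Delta>}" and ?L = "{W \<in> F'. \<not> ?n W \<le> N + \<Delta>}"
  have "inj_on ((`) prod.swap) F'" by (rule inj_on_inverseI[where g = "(`) prod.swap"]) simp
  moreover have "F = (`) prod.swap ` F'" by (simp add: F'_def image_image)
  ultimately have "(\<Sum>W\<in>F. ?w W) = (\<Sum>W\<in>F'. ?w (prod.swap ` W))" by (simp add: sum.reindex)
  also have "\<dots> = (\<Sum>W\<in>?S. ?w (prod.swap ` W)) + (\<Sum>W\<in>?L. ?w (prod.swap ` W))"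
    using F'(1) by (subst sum.union_disjoint[symmetric]) (auto intro!: sum.cong)
  also have "(\<Sum>W\<in>?S. ?w (prod.swap ` W)) \<le> s * ?\<tau>"
  proof -
    have "(\<Sum>W\<in>?S. ?w (prod.swap ` W)) \<le> (\<Sum>W\<in>?S. s * (?w W * p_h ^ (22 * ?n W)))"
    proof (intro sum_mono closed_weight_short_boundary)
      fix W assume W: "W \<in> ?S"
      show "region W" "(x1, x2) \<in> W" "?n W \<le> nat (2 * (x1 + x2 + 2)) + \<Delta>"
        using W regs by (auto simp: N_def)
    qed (use assms in auto)
    also have "\<dots> = s * (\<Sum>W\<in>?S. ?w W * p_h ^ (22 * ?n W))" by (simp add: sum_distrib_left)
    also have "\<dots> \<le> s * ?\<tau>"
      using F' p s by (intro mult_left_mono sum_le_truncated_connectivity) auto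
    finally show ?thesis .
  qed
  also have "(\<Sum>W\<in>?L. ?w (prod.swap ` W)) \<le> \<epsilon> * ?\<tau>"
  proof -
    have "1 \<le> 2 ^ 45 / \<eta>" using \<eta> by (simp add: field_simps)
    then have B: "1 \<le> (2 ^ 45 / \<eta>) ^ K" by (rule one_le_power)
    have "2 ^ 23 * q \<le> (2 ^ 45 / \<eta>) ^ K * (2 ^ 23 * q)"
      using mult_right_mono[OF B, of "2 ^ 23 * q"] q by simp
    then have q1: "2 ^ 23 * q \<le> 1" using \<epsilon> unfolding q_def by linarith
    \<comment> \<open>A factor \<open>(1 / 2) ^ 23\<close> per boundary edge is set aside for the
      entropy bound; the remaining base \<open>2 ^ 23 * q\<close> is at most 1, so its exponent may
      be lowered to \<open>N + \<Delta>\<close>.\<close>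
    have long: "?w (prod.swap ` W) \<le> (2 ^ 23 * q) ^ (N + \<Delta>) * (1 / 2) ^ (23 * ?n W)" if W: "W \<in> ?L" for W
    proof -
      have fin: "finite W" using W regs by simp
      have "?w (prod.swap ` W) \<le> q ^ card (vboundary W) * q ^ card (hboundary W)"
        unfolding closed_weight_def card_boundary_swap[OF fin] q_def
        using p by (intro mult_mono power_mono) auto
      also have "\<dots> = q ^ ?n W" by (simp add: card_boundary[OF fin] power_add)
      also have "\<dots> = (2 ^ 23 * q * (1 / 2) ^ 23) ^ ?n W" by (simp add: power_one_over)
      also have "\<dots> = (2 ^ 23 * q) ^ ?n W * (1 / 2) ^ (23 * ?n W)"
        by (simp only: power_mult_distrib power_mult)
      also have "\<dots> \<le> (2 ^ 23 * q) ^ (N + \<Delta>) * (1 / 2) ^ (23 * ?n W)"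
        using W q q1 by (intro mult_right_mono power_decreasing) auto
      finally show ?thesis .
    qed
    have "(\<Sum>W\<in>?L. ?w (prod.swap ` W)) \<le> (\<Sum>W\<in>?L. (2 ^ 23 * q) ^ (N + \<Delta>) * (1 / 2) ^ (23 * ?n W))"
      using long by (rule sum_mono)
    also have "\<dots> = (2 ^ 23 * q) ^ (N + \<Delta>) * (\<Sum>W\<in>?L. (1 / 2) ^ (23 * ?n W))"
      by (simp add: sum_distrib_left)
    also have "\<dots> \<le> (2 ^ 23 * q) ^ (N + \<Delta>)"
      using sum_regions_le_1[of ?L] F'(1) regs q by (intro mult_left_le) auto
    \<comment> \<open>The lower bound for \<open>?\<tau>\<close> is split off; the quotient of the
      bases \<open>2 ^ 23 * q\<close> and \<open>\<eta> * q / 2 ^ 22\<close> is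
      \<open>2 ^ 45 / \<eta>\<close>.\<close>
    also have "\<dots> = (2 ^ 45 / \<eta>) ^ N * (2 ^ 23 * q) ^ \<Delta> * (\<eta> * q / 2 ^ 22) ^ N"
    proof -
      have "2 ^ 23 * q = (2 ^ 45 / \<eta>) * (\<eta> * q / 2 ^ 22)" using \<eta> by simp
      then have "(2 ^ 23 * q) ^ N = (2 ^ 45 / \<eta>) ^ N * (\<eta> * q / 2 ^ 22) ^ N"
        by (metis power_mult_distrib)
      then show ?thesis by (simp add: power_add)
    qed
    also have "\<dots> \<le> \<epsilon> * ?\<tau>"
    proof (intro mult_mono)
      \<comment> \<open>As \<open>N \<le> K * \<Delta>\<close>, the loss is a fixed constant to the
        power \<open>\<Delta>\<close>, and one factor \<open>q\<close> per unit of
        \<open>\<Delta>\<close> makes up for it.\<close>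
      have "(2 ^ 45 / \<eta>) ^ N * (2 ^ 23 * q) ^ \<Delta> \<le> (2 ^ 45 / \<eta>) ^ (K * \<Delta>) * (2 ^ 23 * q) ^ \<Delta>"
        using \<Delta>(2) q \<open>1 \<le> 2 ^ 45 / \<eta>\<close> by (intro mult_right_mono power_increasing) (auto simp: N_def)
      also have "\<dots> = ((2 ^ 45 / \<eta>) ^ K * (2 ^ 23 * q)) ^ \<Delta>"
        by (simp only: power_mult power_mult_distrib)
      also have "\<dots> \<le> \<epsilon> ^ \<Delta>" using \<epsilon>(1) q B unfolding q_def by (intro power_mono) auto
      also have "\<dots> \<le> \<epsilon> ^ 1"
      proof (rule power_decreasing)
        have "0 \<le> (2 ^ 45 / \<eta>) ^ K * (2 ^ 23 * q)" using B q by simp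
        then show "0 \<le> \<epsilon>" using \<epsilon>(1) unfolding q_def by linarith
      qed (use \<epsilon>(2) x(2) \<Delta>(1) in auto)
      finally show "(2 ^ 45 / \<eta>) ^ N * (2 ^ 23 * q) ^ \<Delta> \<le> \<epsilon>" by simp
      show "(\<eta> * q / 2 ^ 22) ^ N \<le> ?\<tau>"
        unfolding N_def q_def using x p \<eta> by (intro truncated_connectivity_ge) auto
      have "0 \<le> (2 ^ 45 / \<eta>) ^ K * (2 ^ 23 * q)" using B q by simp
      then show "0 \<le> \<epsilon>" using \<epsilon>(1) unfolding q_def by linarith
      show "0 \<le> (\<eta> * q / 2 ^ 22) ^ N" using \<eta> q by simp
    qed
    finally show ?thesis .
  qed
  finally show "(\<Sum>W\<in>F. ?w W) \<le> (s + \<epsilon>) * ?\<tau>" by (simp add: distrib_right)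
qed (use p in auto)

section \<open>Choice of the threshold\<close>

theorem theorem1:
  fixes \<rho> \<eta> :: real
  assumes "\<rho> > 1" and "0 < \<eta>" and "\<eta> < 1"
  shows "\<exists>p_star :: real. 0 < p_star \<and> p_star < 1 \<and>
    (\<forall>p_h p_v :: real.
      p_star < p_h \<longrightarrow> p_h < 1 \<longrightarrow> 0 < p_v \<longrightarrow> p_v < 1 \<longrightarrow>
      (1 - p_v) / p_v = \<eta> * ((1 - p_h) / p_h) \<longrightarrow>
      (\<forall>x1 x2 :: int. 0 < x1 \<longrightarrow> 0 < x2 \<longrightarrow> real_of_int x2 = \<rho> * real_of_int x1 \<longrightarrow>
        truncated_connectivity (p_h, p_v) (0, 0) (x1, x2)
          > truncated_connectivity (p_h, p_v) (0, 0) (x2, x1)))"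
proof -
  \<comment> \<open>Of \<open>\<eta> = s * s\<close>, one factor \<open>s\<close> is the gain and
    the other is spent against powers of \<open>p_h\<close>. Half of the gap between
    \<open>s\<close> and 1 is left for the long boundaries.\<close>
  define s \<epsilon> where "s = sqrt \<eta>" and "\<epsilon> = (1 - sqrt \<eta>) / 2"
  have s: "0 < s" "s < 1" "s * s = \<eta>" using assms by (auto simp: s_def)
  \<comment> \<open>As \<open>x2 = \<rho> * x1\<close>, the ratio of \<open>x1 + x2\<close> to
    \<open>x2 - x1\<close> is \<open>(\<rho> + 1) / (\<rho> - 1)\<close>, so \<open>K\<close> is
    independent of the point.\<close>
  obtain K :: nat where K: "4 * (\<rho> + 1) / (\<rho> - 1) \<le> real K" using real_arch_simple by blast
  \<comment> \<open>The additional 1 in the exponent absorbs the denominator of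
    \<open>\<eta> / p_h\<close>, which plays the role of \<open>\<kappa>\<close>.\<close>
  have "((\<lambda>p::real. p ^ (22 * (K + 1) + 1)) \<longlongrightarrow> 1 ^ (22 * (K + 1) + 1)) (at_left 1)"
    by (intro tendsto_intros)
  then have ev1: "\<forall>\<^sub>F p in at_left (1::real). s < p ^ (22 * (K + 1) + 1)"
    using s by (intro order_tendstoD(1)) auto
  have "((\<lambda>p::real. (2 ^ 45 / \<eta>) ^ K * (2 ^ 23 * (1 - p))) \<longlongrightarrow> (2 ^ 45 / \<eta>) ^ K * (2 ^ 23 * (1 - 1))) (at_left 1)"
    by (intro tendsto_intros)
  then have ev2: "\<forall>\<^sub>F p in at_left (1::real). (2 ^ 45 / \<eta>) ^ K * (2 ^ 23 * (1 - p)) < \<epsilon>"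
    using s by (intro order_tendstoD(2)) (auto simp: \<epsilon>_def s_def)
  from eventually_conj[OF ev1 ev2] obtain b :: real where b: "b < 1"
    "\<And>p. b < p \<Longrightarrow> p < 1 \<Longrightarrow> s < p ^ (22 * (K + 1) + 1) \<and> (2 ^ 45 / \<eta>) ^ K * (2 ^ 23 * (1 - p)) < \<epsilon>"
    by (auto simp: eventually_at_left_field)
  show ?thesis
  proof (intro exI[of _ "max b (1 / 2)"] conjI allI impI)
    fix p_h p_v :: real and x1 x2 :: int
    assume p: "max b (1 / 2) < p_h" "p_h < 1" "0 < p_v" "p_v < 1"
      and odds: "(1 - p_v) / p_v = \<eta> * ((1 - p_h) / p_h)"
      and x: "0 < x1" "0 < x2" "real_of_int x2 = \<rho> * real_of_int x1"
    have ph: "1 / 2 < p_h" "b < p_h" "0 < p_h" using p(1) by auto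
    have eq: "(1 - p_v) * p_h = \<eta> * (1 - p_h) * p_v" using odds ph p by (simp add: field_simps)
    have "\<eta> * (1 - p_h) * p_v \<le> 1 * (1 - p_h) * p_v" using assms p by (intro mult_right_mono) auto
    with eq have hv: "p_h \<le> p_v" by (simp add: algebra_simps)
    have "\<eta> * (1 - p_h) * p_h \<le> (1 - p_v) * p_h"
      unfolding eq using hv assms p by (intro mult_left_mono) auto
    then have lower: "\<eta> * (1 - p_h) \<le> 1 - p_v" using ph by simp
    have "(1 - p_v) * p_h \<le> \<eta> * (1 - p_h)"
      unfolding eq using assms p by (intro mult_left_le) auto
    then have upper: "1 - p_v \<le> \<eta> / p_h * (1 - p_h)" using ph by (simp add: field_simps)
    note b = b(2)[OF ph(2) p(2)]
    have \<epsilon>: "\<epsilon> \<le> 1" using s(1) by (simp add: \<epsilon>_def s_def[symmetric])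
    have "\<eta> = s * s" using s by simp
    also have "\<dots> \<le> s * p_h ^ (22 * (K + 1) + 1)" using s b by (intro mult_left_mono) auto
    also have "\<dots> = s * p_h ^ (22 * (K + 1)) * p_h" by (simp only: power_add power_one_right mult.assoc)
    finally have \<kappa>: "\<eta> / p_h \<le> s * p_h ^ (22 * (K + 1))" using ph by (simp only: pos_divide_le_eq)
    also have "\<dots> \<le> 1" using s p ph by (intro mult_le_one power_le_one) auto
    finally have \<kappa>1: "\<eta> / p_h \<le> 1" .
    have "real_of_int x1 < real_of_int x2" using assms(1) x by (simp add: mult_less_cancel_right2)
    then have x12: "x1 < x2" by simp
    define \<Delta> where "\<Delta> = nat (x2 - x1)"
    \<comment> \<open>The constant 2 is absorbed because \<open>x1 + x2\<close> is at least
      2.\<close>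
    have "real (nat (2 * (x1 + x2 + 2))) \<le> 4 * real_of_int (x1 + x2)" using x(1) x12 by simp
    also have "\<dots> = 4 * (\<rho> + 1) / (\<rho> - 1) * ((\<rho> - 1) * real_of_int x1)"
      using assms(1) x(3) by (simp add: field_simps)
    also have "\<dots> \<le> real K * ((\<rho> - 1) * real_of_int x1)"
      using K x assms(1) by (intro mult_right_mono) auto
    also have "(\<rho> - 1) * real_of_int x1 = real \<Delta>" using x12 x(3) by (simp add: \<Delta>_def algebra_simps)
    finally have "nat (2 * (x1 + x2 + 2)) \<le> K * \<Delta>" by (metis of_nat_le_iff of_nat_mult)
    then have "truncated_connectivity (p_h, p_v) (0, 0) (x2, x1)
        \<le> (s + \<epsilon>) * truncated_connectivity (p_h, p_v) (0, 0) (x1, x2)"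
      using x(1) x12 ph p hv lower upper assms \<kappa> \<kappa>1 s b \<epsilon>
      by (intro truncated_connectivity_reflect[where \<Delta> = \<Delta> and \<kappa> = "\<eta> / p_h" and K = K and \<eta> = \<eta>])
        (auto simp: \<Delta>_def)
    also have "\<dots> < 1 * truncated_connectivity (p_h, p_v) (0, 0) (x1, x2)"
    proof (rule mult_strict_right_mono)
      have "0 < (\<eta> * (1 - p_h) / 2 ^ 22) ^ nat (2 * (x1 + x2 + 2))" using assms p by simp
      also have "\<dots> \<le> truncated_connectivity (p_h, p_v) (0, 0) (x1, x2)"
        using x ph p hv lower assms by (intro truncated_connectivity_ge) auto
      finally show "0 < truncated_connectivity (p_h, p_v) (0, 0) (x1, x2)" .
      show "s + \<epsilon> < 1" using s(2) by (simp add: \<epsilon>_def s_def field_simps)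
    qed
    finally show "truncated_connectivity (p_h, p_v) (0, 0) (x1, x2)
        > truncated_connectivity (p_h, p_v) (0, 0) (x2, x1)" by simp
  qed (use b(1) in auto)
qed

end
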